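(* Let $0<m\le L<\infty$ and let $\mathcal{A}=(\alpha,\beta,\eta)$ be a three-parameter algorithm with real parameters, applied to functions in $Q_{m,L}$, with noise satisfying the noise assumption. Then $$\mathrm{rate}(\mathcal{A},Q_{m,L})=\max_{q\in\{m,L\}}\begin{cases}\sqrt{\beta-\alpha\eta q}&\text{if }\Delta<0,\\[2pt] \frac12\bigl(|\beta+1-\alpha q-\alpha\eta q|+\sqrt\Delta\bigr)&\text{if }\Delta\ge0,\end{cases}$$ where $\Delta=(\beta+1-\alpha q-\alpha\eta q)^2-4(\beta-\alpha\eta q)$. If $\mathrm{rate}(\mathcal{A},Q_{m,L})<1$, then $$\mathrm{sens}(\mathcal{A},Q_{m,L})=\max_{q\in\{m,L\}}\sqrt{\frac{\alpha\bigl(1+\beta+(1+2\eta)\alpha\eta q\bigr)}{q\,(1-\beta+\alpha\eta q)\bigl(2+2\beta-(1+2\eta)\alpha q\bigr)}}.$$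
   Context: Points of $\mathbb{R}^d$ are written as row vectors in $\mathbb{R}^{1\times d}$, $\nabla f:\mathbb{R}^{1\times d}\to\mathbb{R}^{1\times d}$, and $\|\cdot\|$ is the Frobenius norm. Function class $Q_{m,L}$: functions $f:\mathbb{R}^d\to\mathbb{R}$ such that for some $f^\star\in\mathbb{R}$, $y^\star\in\mathbb{R}^d$ and symmetric $Q\in\mathbb{R}^{d\times d}$ with all eigenvalues in $[m,L]$, $f(y)=\frac12(y-y^\star)Q(y-y^\star)^{\mathsf T}+f^\star$ ($y$ a row vector). $y^\star$ is the unique minimizer. Algorithms: $\mathcal{A}=(A,B,C)$ with $A\in\mathbb{R}^{n\times n}$, $B\in\mathbb{R}^{n\times1}$, $C\in\mathbb{R}^{1\times n}$ denotes the iteration $\xi^{t+1}=A\xi^t+B(u^t+w^t)$, $y^t=C\xi^t$, $u^t=\nabla f(y^t)$, where $\xi^t\in\mathbb{R}^{n\times d}$ is the state and $w^t\in\mathbb{R}^{1\times d}$ the noise. A fixed point $\xi^\star$ satisfies $\xi^\star=A\xi^\star$, $y^\star=C\xi^\star$. The three-parameter algorithm $(\alpha,\beta,\eta)$ is $x^{t+1}=x^t-\alpha\,g\bigl(x^t+\eta(x^t-x^{t-1})\bigr)+\beta(x^t-x^{t-1})$, where $g(x)=\nabla f(x)+w$ is the noisy gradient oracle ($w=w^t$ at iteration $t$); it is of the form $(A,B,C)$ with $n=2$, state $\xi^t=\begin{bmatrix}x^t\\ x^{t-1}\end{bmatrix}$, $A=\begin{bmatrix}1+\beta&-\beta\\ 1&0\end{bmatrix}$,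 $B=\begin{bmatrix}-\alpha\\ 0\end{bmatrix}$, $C=\begin{bmatrix}1+\eta&-\eta\end{bmatrix}$. Convergence rate (computed with $w^t=0$ for all $t$): for a function class $\mathcal{F}$, $$\mathrm{rate}(\mathcal{A},\mathcal{F})=\inf\Bigl\{r>0:\ \sup_{f\in\mathcal{F}}\sup_{\xi^0\in\mathbb{R}^{n\times d}}\sup_{t\ge0}\frac{\|\xi^t-\xi^\star\|}{r^t\|\xi^0-\xi^\star\|}<\infty\Bigr\}.$$ Noise assumption (with parameter $\sigma>0$): the joint distribution $\mathbb{P}$ of $w^0,w^1,\dots$ lies in $\mathcal{P}_\sigma$, the set of all joint distributions for which the $w^t$ are independent across $t$ (not necessarily identically distributed), $\mathbb{E}\,w^t=0$, and $\mathbb{E}\|w^t\|^2\le\sigma^2$ for all $t$. Sensitivity: $$\mathrm{sens}(\mathcal{A},\mathcal{F})=\sup_{f\in\mathcal{F}}\sup_{\xi^0\in\mathbb{R}^{n\times d}}\sup_{\mathbb{P}\in\mathcal{P}_\sigma}\limsup_{T\to\infty}\sqrt{\mathbb{E}_{w\sim\mathbb{P}}\frac{1}{\sigma^2T}\sum_{t=0}^{T-1}\|y^t-y^\star\|^2}.$$ *)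

theory Defs
  imports "HOL-Probability.Probability"
begin

text \<open>
  Points of \<open>\<real>\<^sup>d\<close> are row vectors of type \<^typ>\<open>real^'d^1\<close>, states are
  \<open>n \<times> d\<close> matrices of type \<^typ>\<open>real^'d^'n\<close>. The library norm on
  \<^typ>\<open>real^'d^'n\<close> is the Frobenius norm, and its inner product is the entrywise one.
\<close>


section \<open>The function class\<close>

definition eigenvalue :: "real^'d^'d \<Rightarrow> real \<Rightarrow> bool" where
  "eigenvalue Q c \<longleftrightarrow> (\<exists>v. v \<noteq> 0 \<and> Q *v v = c *\<^sub>R v)"

text \<open>Only real eigenvalues are constrained; a real symmetric matrix has no others.\<close>

definition quad_class :: "real \<Rightarrow> real \<Rightarrow> (real^'d^1 \<Rightarrow> real) set" where
  "quad_class m L = {f. \<exists>fs ys Q. transpose Q = Q \<and> (\<forall>c. eigenvalue Q c \<longrightarrow> m \<le> c \<and> c \<le> L) \<and>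
     f = (\<lambda>y. 1/2 * ((y - ys) ** Q ** transpose (y - ys)) $ 1 $ 1 + fs)}"

definition grad :: "('a::real_inner \<Rightarrow> real) \<Rightarrow> 'a \<Rightarrow> 'a" where
  "grad f x = (THE D. GDERIV f x :> D)"

definition minimizer :: "('a \<Rightarrow> real) \<Rightarrow> 'a" where
  "minimizer f = (THE y. \<forall>z. f y \<le> f z)"


section \<open>Algorithms\<close>

record 'n algorithm =
  matA :: "real^'n^'n"
  matB :: "real^1^'n"
  matC :: "real^'n^1"

primrec state :: "'n::finite algorithm \<Rightarrow> (real^'d^1 \<Rightarrow> real) \<Rightarrow> (nat \<Rightarrow> real^'d^1) \<Rightarrow>
    real^'d^'n \<Rightarrow> nat \<Rightarrow> real^'d^'n" where
  "state \<A> f w \<xi>0 0 = \<xi>0"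
| "state \<A> f w \<xi>0 (Suc t) =
     matA \<A> ** state \<A> f w \<xi>0 t + matB \<A> ** (grad f (matC \<A> ** state \<A> f w \<xi>0 t) + w t)"

definition sys_output :: "'n::finite algorithm \<Rightarrow> (real^'d^1 \<Rightarrow> real) \<Rightarrow> (nat \<Rightarrow> real^'d^1) \<Rightarrow>
    real^'d^'n \<Rightarrow> nat \<Rightarrow> real^'d^1" where
  "sys_output \<A> f w \<xi>0 t = matC \<A> ** state \<A> f w \<xi>0 t"

definition fixed_points :: "'n::finite algorithm \<Rightarrow> (real^'d^1 \<Rightarrow> real) \<Rightarrow> (real^'d^'n) set" where
  "fixed_points \<A> f = {\<xi>. \<xi> = matA \<A> ** \<xi> \<and> minimizer f = matC \<A> ** \<xi>}"

definition three_param :: "real \<Rightarrow> real \<Rightarrow> real \<Rightarrow> 2 algorithm" where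
  "three_param \<alpha> \<beta> \<eta> = \<lparr>
     matA = vector [vector [1 + \<beta>, - \<beta>], vector [1, 0]],
     matB = vector [vector [- \<alpha>], vector [0]],
     matC = vector [vector [1 + \<eta>, - \<eta>]]\<rparr>"

text \<open>Row 1 of the state is the current iterate, row 2 the previous one.\<close>

lemma three_param_recursion:
  fixes f :: "real^'d^1 \<Rightarrow> real" and w :: "nat \<Rightarrow> real^'d^1" and \<xi>0 :: "real^'d^2"
    and \<alpha> \<beta> \<eta> :: real
  defines "x \<equiv> \<lambda>t. (vector [state (three_param \<alpha> \<beta> \<eta>) f w \<xi>0 t $ 1] :: real^'d^1)"
      and "p \<equiv> \<lambda>t. (vector [state (three_param \<alpha> \<beta> \<eta>) f w \<xi>0 t $ 2] :: real^'d^1)"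
  shows "x (Suc t) = x t - \<alpha> *\<^sub>R (grad f (x t + \<eta> *\<^sub>R (x t - p t)) + w t) + \<beta> *\<^sub>R (x t - p t)"
    and "p (Suc t) = x t"
proof -
  have y: "matC (three_param \<alpha> \<beta> \<eta>) ** state (three_param \<alpha> \<beta> \<eta>) f w \<xi>0 t =
      x t + \<eta> *\<^sub>R (x t - p t)"
    by (simp add: x_def p_def three_param_def matrix_matrix_mult_def vec_eq_iff sum_2
        algebra_simps)
  show "x (Suc t) = x t - \<alpha> *\<^sub>R (grad f (x t + \<eta> *\<^sub>R (x t - p t)) + w t) + \<beta> *\<^sub>R (x t - p t)"
    unfolding y[symmetric]
    by (simp add: x_def p_def three_param_def matrix_matrix_mult_def vec_eq_iff sum_2
        algebra_simps)
  show "p (Suc t) = x t"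
    by (simp add: x_def p_def three_param_def matrix_matrix_mult_def vec_eq_iff sum_2)
qed

lemma fixed_points_three_param:
  "fixed_points (three_param \<alpha> \<beta> \<eta>) f = {vector [minimizer f $ 1, minimizer f $ 1]}"
  by (auto simp: fixed_points_def three_param_def matrix_matrix_mult_def vec_eq_iff sum_2
      forall_2 algebra_simps)


section \<open>Convergence rate\<close>

text \<open>
  At \<open>\<xi>\<^sup>0 = \<xi>\<^sup>\<star>\<close> the quotient is \<open>0/0 = 0\<close> for every \<open>t\<close>, so this initial state does not
  contribute to the supremum. The fixed point is unique for the three-parameter algorithm;
  for other algorithms, presupposed to have one, the supremum ranges over all fixed points.
\<close>

definition rate :: "'n::finite algorithm \<Rightarrow> (real^'d^1 \<Rightarrow> real) set \<Rightarrow> ereal" where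
  "rate \<A> F = (INF r \<in> {r::real. r > 0 \<and>
     (SUP f\<in>F. SUP \<xi>s\<in>fixed_points \<A> f. SUP \<xi>0. SUP t.
        ereal (norm (state \<A> f (\<lambda>_. 0) \<xi>0 t - \<xi>s) / (r ^ t * norm (\<xi>0 - \<xi>s)))) < \<infinity>}. ereal r)"


section \<open>Sensitivity\<close>

definition noise :: "real \<Rightarrow> (nat \<Rightarrow> real^'d^1) measure set" where
  "noise \<sigma> = {P. prob_space P \<and> sets P = sets (\<Pi>\<^sub>M t\<in>UNIV. borel) \<and>
     prob_space.indep_vars P (\<lambda>_. borel) (\<lambda>t w. w t) UNIV \<and>
     (\<forall>t. integrable P (\<lambda>w. w t) \<and> (\<integral>w. w t \<partial>P) = 0 \<and>
          (\<integral>\<^sup>+w. ennreal ((norm (w t))\<^sup>2) \<partial>P) \<le> ennreal (\<sigma>\<^sup>2))}"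

definition ereal_sqrt :: "ereal \<Rightarrow> ereal" where
  "ereal_sqrt x = (if \<bar>x\<bar> = \<infinity> then x else ereal (sqrt (real_of_ereal x)))"

definition sens :: "real \<Rightarrow> 'n::finite algorithm \<Rightarrow> (real^'d^1 \<Rightarrow> real) set \<Rightarrow> ereal" where
  "sens \<sigma> \<A> F = (SUP f\<in>F. SUP \<xi>0. SUP P\<in>noise \<sigma>.
     limsup (\<lambda>T. ereal_sqrt (enn2ereal (\<integral>\<^sup>+w. ennreal (1 / (\<sigma>\<^sup>2 * real T) *
       (\<Sum>t<T. (norm (sys_output \<A> f w \<xi>0 t - minimizer f))\<^sup>2)) \<partial>P))))"

end

theory Submission
  imports Defs
begin

text \<open>
  In an orthonormal eigenbasis of \<open>Q\<close> the iteration decouples into scalar recurrences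
  \<open>z\<^sub>t\<^sub>+\<^sub>1 = b z\<^sub>t - c z\<^sub>t\<^sub>-\<^sub>1 - \<alpha> u\<^sub>t\<close> with \<open>b\<close>, \<open>c\<close> affine in the eigenvalue \<open>q\<close>. The
  growth rate of a mode is the larger modulus of the roots of \<open>z\<^sup>2 - b z + c\<close>; that it is at most
  \<open>r\<close> is expressed by the Jury conditions, which are preserved under convex combinations of \<open>q\<close>,
  so the worst mode sits at \<open>m\<close> or \<open>L\<close>. For uncorrelated noise the output energy of a mode is
  governed by the energy of its impulse response, which a Lyapunov function evaluates in closed form.
  This gain is a convex function of \<open>q\<close>, so it too is maximal at an endpoint, and there it is attained
  by an isotropic quadratic driven by independent two-point noise of full power.
\<close>

section \<open>Orthogonal diagonalization of self-adjoint maps\<close>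

text \<open>The rate asks for a single finite bound over all quadratics, initial states and times,
  so the asymptotics of each mode separately are not enough: the constant of the geometric bound
  must be common to all modes. It is obtained by estimating the fundamental solution through the
  moduli of the roots alone. The price is a factor linear in \<open>t\<close>, which double roots
  really produce; any \<open>r\<close> strictly above the largest radius absorbs it, and the infimum
  does not notice this loss.

  For the sensitivity, the initial state contributes an energy that is bounded in \<open>T\<close>
  and hence vanishes under the time average. The noise assumption bounds only the total power of
  each \<open>w t\<close>, not its distribution over the coordinates. Parseval makes this harmless:
  the variances along the modes add up to the total power, so the output power is a combination of
  mode gains with total weight at most \<open>\<sigma>\<^sup>2\<close> per time step, and the
  largest gain dominates it. The two-point noise spreads its power over the modes in an uncontrolled
  way as well, which is why the extremal quadratic is isotropic: all its modes then have the same
  gain.\<close>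

text \<open>A maximizer of the quadratic form on the unit sphere of \<open>S\<close> is an
  eigenvector, for otherwise the residual \<open>f v - c *\<^sub>R v\<close> would be a direction of
  ascent.\<close>

lemma self_adjoint_eigenvector:
  fixes f :: "'a::euclidean_space \<Rightarrow> 'a"
  assumes lin: "linear f" and sa: "\<And>x y. f x \<bullet> y = x \<bullet> f y"
    and S: "subspace S" "f ` S \<subseteq> S" and u: "u \<in> S" "u \<noteq> 0"
  obtains v c where "v \<in> S" "norm v = 1" "f v = c *\<^sub>R v"
proof -
  have "compact (sphere 0 1 \<inter> S)"
    by (intro compact_Int_closed closed_subspace S) auto
  moreover have "sgn u \<in> sphere 0 1 \<inter> S"
    using u by (auto simp: sgn_div_norm norm_sgn intro: subspace_scale S)
  moreover have "continuous_on (sphere 0 1 \<inter> S) (\<lambda>x. x \<bullet> f x)"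
    by (intro continuous_intros linear_continuous_on) (simp add: lin linear_conv_bounded_linear[symmetric])
  ultimately obtain v where v: "v \<in> S" "norm v = 1"
    and max: "\<And>x. x \<in> S \<Longrightarrow> norm x = 1 \<Longrightarrow> x \<bullet> f x \<le> v \<bullet> f v"
    using continuous_attains_sup[of "sphere 0 1 \<inter> S" "\<lambda>x. x \<bullet> f x"]
    by (metis Int_iff empty_iff mem_sphere_0)
  define c where "c = v \<bullet> f v"
  have max': "x \<bullet> f x \<le> c * (x \<bullet> x)" if "x \<in> S" for x
  proof (cases "x = 0")
    case False
    have "sgn x \<bullet> f (sgn x) \<le> c"
      unfolding c_def using that False by (intro max) (auto simp: sgn_div_norm intro: subspace_scale S)
    then show ?thesis using False
      by (simp add: sgn_div_norm linear_scale[OF lin] dot_square_norm field_simps power2_eq_square)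
  qed simp
  define w where "w = f v - c *\<^sub>R v"
  have wS: "w \<in> S" unfolding w_def
    using S v by (intro subspace_diff subspace_scale) auto
  have vv: "v \<bullet> v = 1" using v by (simp add: dot_square_norm)
  have vw: "v \<bullet> w = 0" by (simp add: w_def inner_diff_right c_def vv)
  then have fvw: "f v \<bullet> w = w \<bullet> w" by (simp add: w_def inner_diff_left)
  \<comment> \<open>first-order optimality of \<open>v\<close> along \<open>w\<close>, at step size \<open>t\<close>\<close>
  have opt: "2 * t * (w \<bullet> w) \<le> t\<^sup>2 * (c * (w \<bullet> w) - w \<bullet> f w)" for t :: real
  proof -
    have "(v + t *\<^sub>R w) \<bullet> f (v + t *\<^sub>R w) \<le> c * ((v + t *\<^sub>R w) \<bullet> (v + t *\<^sub>R w))"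
      using v wS S by (intro max' subspace_add subspace_scale)
    moreover have "v \<bullet> f w = w \<bullet> w" using fvw sa by simp
    moreover have "w \<bullet> f v = w \<bullet> w" using fvw by (simp add: inner_commute)
    moreover have "w \<bullet> v = 0" using vw by (simp add: inner_commute)
    ultimately show ?thesis
      using vw by (simp add: linear_add[OF lin] linear_scale[OF lin] inner_add_left inner_add_right
          c_def[symmetric] vv algebra_simps power2_eq_square)
  qed
  have "w = 0"
  proof (rule ccontr)
    assume "w \<noteq> 0"
    then have pos: "w \<bullet> w > 0" by simp
    define k where "k = c * (w \<bullet> w) - w \<bullet> f w"
    \<comment> \<open>A step so short that the second-order term \<open>t * k\<close> is at most
      \<open>w \<bullet> w\<close>, half of the first-order gain. The summand 1 keeps the
      denominator positive when \<open>k = 0\<close>.\<close>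
    define t where "t = (w \<bullet> w) / (\<bar>k\<bar> + 1)"
    have t: "t > 0" using pos by (simp add: t_def)
    have "2 * (w \<bullet> w) \<le> t * k"
      using opt[of t] t by (simp add: k_def[symmetric] power2_eq_square mult.assoc)
    also have "\<dots> \<le> t * (\<bar>k\<bar> + 1)" using t by (intro mult_left_mono) auto
    also have "\<dots> = w \<bullet> w" by (simp add: t_def)
    finally show False using pos by simp
  qed
  then have "f v = c *\<^sub>R v" by (simp add: w_def)
  with v that show thesis by blast
qed

text \<open>Split off one eigenvector and recurse on its orthogonal complement within
  \<open>S\<close>, which \<open>f\<close> leaves invariant because it is self-adjoint. Parseval's
  identity passes through the induction by Pythagoras.\<close>

lemma self_adjoint_eigenbasis:
  fixes f :: "'a::euclidean_space \<Rightarrow> 'a"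
  assumes lin: "linear f" and sa: "\<And>x y. f x \<bullet> y = x \<bullet> f y"
    and "subspace S" "f ` S \<subseteq> S"
  shows "\<exists>B c. finite B \<and> B \<subseteq> S \<and> (\<forall>e\<in>B. norm e = 1 \<and> f e = c e *\<^sub>R e) \<and>
    (\<forall>x\<in>S. (norm x)\<^sup>2 = (\<Sum>e\<in>B. (x \<bullet> e)\<^sup>2))"
  using assms(3,4)
proof (induction "dim S" arbitrary: S rule: less_induct)
  case less
  show ?case
  proof (cases "S \<subseteq> {0}")
    case True
    then show ?thesis by (intro exI[of _ "{}"]) auto
  next
    case False
    then obtain u where "u \<in> S" "u \<noteq> 0" by auto
    from self_adjoint_eigenvector[OF lin sa less.prems this]
    obtain v c where v: "v \<in> S" "norm v = 1" "f v = c *\<^sub>R v" .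
    have vv: "v \<bullet> v = 1" using v by (simp add: dot_square_norm)
    define S' where "S' = {x \<in> S. x \<bullet> v = 0}"
    have sub: "subspace S'"
      using less.prems(1) by (auto simp: S'_def subspace_def inner_add_left)
    have inv: "f ` S' \<subseteq> S'"
      using less.prems(2) by (auto simp: S'_def sa v)
    have "v \<notin> S'" by (simp add: S'_def vv)
    then have "dim S' < dim S"
      using v less.prems(1) sub
      by (metis (no_types, lifting) S'_def dim_subset mem_Collect_eq nat_less_le subsetI subspace_dim_equal order_eq_refl)
    from less.hyps[OF this sub inv] obtain B k where B: "finite B" "B \<subseteq> S'"
      "\<forall>e\<in>B. norm e = 1 \<and> f e = k e *\<^sub>R e"
      "\<forall>x\<in>S'. (norm x)\<^sup>2 = (\<Sum>e\<in>B. (x \<bullet> e)\<^sup>2)" by blast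
    have vB: "v \<notin> B" using B \<open>v \<notin> S'\<close> by auto
    have "(norm x)\<^sup>2 = (\<Sum>e\<in>insert v B. (x \<bullet> e)\<^sup>2)" if x: "x \<in> S" for x
    proof -
      define y where "y = x - (x \<bullet> v) *\<^sub>R v"
      have yv: "y \<bullet> v = 0" by (simp add: y_def inner_diff_left vv)
      then have "y \<in> S'"
        using x v less.prems(1) by (auto simp: S'_def y_def intro: subspace_diff subspace_scale)
      have ye: "y \<bullet> e = x \<bullet> e" if "e \<in> B" for e
        using that B(2) by (auto simp: y_def S'_def inner_diff_left inner_commute[of v])
      have "x = (x \<bullet> v) *\<^sub>R v + y" by (simp add: y_def)
      moreover have "orthogonal ((x \<bullet> v) *\<^sub>R v) y"
        using yv by (simp add: orthogonal_def inner_commute)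
      ultimately have "(norm x)\<^sup>2 = (norm ((x \<bullet> v) *\<^sub>R v))\<^sup>2 + (norm y)\<^sup>2"
        by (metis norm_add_Pythagorean)
      also have "(norm y)\<^sup>2 = (\<Sum>e\<in>B. (x \<bullet> e)\<^sup>2)"
        using B(4) \<open>y \<in> S'\<close> ye by simp
      finally show ?thesis using vB B(1) v by simp
    qed
    moreover have "\<forall>e\<in>insert v B. norm e = 1 \<and> f e = (k(v := c)) e *\<^sub>R e"
      using v B vB by auto
    moreover have "insert v B \<subseteq> S" using v B by (auto simp: S'_def)
    ultimately show ?thesis using B(1) by (intro exI[of _ "insert v B"] exI[of _ "k(v := c)"]) blast
  qed
qed


section \<open>The scalar recurrence\<close>

text \<open>For distinct roots \<open>z1\<close>, \<open>z2\<close> of the characteristic polynomial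
  this is \<open>(z1 ^ t - z2 ^ t) / (z1 - z2)\<close>. All solutions are combinations of it and its
  shift.\<close>

fun fund :: "real \<Rightarrow> real \<Rightarrow> nat \<Rightarrow> real" where
  "fund b c 0 = 0"
| "fund b c (Suc 0) = 1"
| "fund b c (Suc (Suc t)) = b * fund b c (Suc t) - c * fund b c t"

definition char_radius :: "real \<Rightarrow> real \<Rightarrow> real" where
  "char_radius b c = (let \<Delta> = b\<^sup>2 - 4 * c
     in if \<Delta> < 0 then sqrt c else 1/2 * (\<bar>b\<bar> + sqrt \<Delta>))"

text \<open>Working with complex roots removes the case distinction on the discriminant from the
  growth estimates. A conjugate pair has the common modulus \<open>sqrt c\<close>, since its product
  is \<open>c\<close>; of two real roots the larger modulus is half of \<open>\<bar>b\<bar>\<close>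
  plus the root of the discriminant.\<close>

lemma char_roots:
  obtains z1 z2 :: complex where "z1 + z2 = of_real b" "z1 * z2 = of_real c"
    "char_radius b c = max (norm z1) (norm z2)"
proof (cases "b\<^sup>2 - 4 * c < 0")
  case True
  define s where "s = sqrt (4 * c - b\<^sup>2)"
  have s: "s\<^sup>2 = 4 * c - b\<^sup>2" using True by (simp add: s_def)
  have bs: "(b/2)\<^sup>2 + (s/2)\<^sup>2 = c" by (simp add: power_divide s diff_divide_distrib)
  then have "norm (Complex (b/2) (s/2)) = sqrt c" "norm (Complex (b/2) (- s/2)) = sqrt c"
    by (simp_all add: cmod_def power_divide)
  moreover have "Complex (b/2) (s/2) * Complex (b/2) (- s/2) = of_real c"
    using bs by (simp add: complex_eq_iff power2_eq_square)
  moreover have "Complex (b/2) (s/2) + Complex (b/2) (- s/2) = of_real b"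
    by (simp add: complex_eq_iff)
  ultimately show ?thesis using True
    by (intro that[of "Complex (b/2) (s/2)" "Complex (b/2) (- s/2)"]) (auto simp: char_radius_def)
next
  case False
  define s where "s = sqrt (b\<^sup>2 - 4 * c)"
  have s: "s\<^sup>2 = b\<^sup>2 - 4 * c" "s \<ge> 0" using False by (simp_all add: s_def)
  show ?thesis
  proof (rule that[of "of_real ((b + s) / 2)" "of_real ((b - s) / 2)"])
    show "complex_of_real ((b + s) / 2) + of_real ((b - s) / 2) = of_real b"
      unfolding of_real_add[symmetric] by (simp add: field_simps)
    have "(b + s) / 2 * ((b - s) / 2) = (b\<^sup>2 - s\<^sup>2) / 4" by (simp add: field_simps power2_eq_square)
    then have "(b + s) / 2 * ((b - s) / 2) = c" unfolding s by simp
    then show "complex_of_real ((b + s) / 2) * of_real ((b - s) / 2) = of_real c"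
      unfolding of_real_mult[symmetric] by simp
    show "char_radius b c = max (norm (complex_of_real ((b + s) / 2))) (norm (complex_of_real ((b - s) / 2)))"
      unfolding norm_of_real char_radius_def Let_def s_def[symmetric]
      using False s(2) by (auto simp: max_def abs_if field_simps)
  qed
qed

text \<open>Removing the root \<open>z2\<close> leaves a recurrence of first order with ratio
  \<open>z1\<close>. Unlike the explicit formula with \<open>z1 - z2\<close> in the denominator,
  this survives a double root, and it yields both the upper and the lower growth estimate.\<close>

lemma fund_root:
  assumes "z1 + z2 = of_real b" "z1 * z2 = (of_real c :: complex)"
  shows "of_real (fund b c (Suc t)) - z2 * of_real (fund b c t) = z1 ^ t"
proof (induction t)
  case (Suc t)
  have "complex_of_real (fund b c (Suc (Suc t))) - z2 * of_real (fund b c (Suc t))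
      = (z1 + z2) * of_real (fund b c (Suc t)) - z1 * z2 * of_real (fund b c t) - z2 * of_real (fund b c (Suc t))"
    by (simp add: assms)
  also have "\<dots> = z1 * (of_real (fund b c (Suc t)) - z2 * of_real (fund b c t))"
    by (simp add: algebra_simps)
  finally show ?case using Suc by simp
qed simp

lemma char_radius_nonneg: "char_radius b c \<ge> 0"
  by (rule char_roots[of b c]) (simp add: le_max_iff_disj)

lemma fund_bound: "\<bar>fund b c (Suc t)\<bar> \<le> real (Suc t) * char_radius b c ^ t"
proof (induction t)
  case (Suc t)
  obtain z1 z2 where z: "z1 + z2 = complex_of_real b" "z1 * z2 = of_real c"
    and r: "char_radius b c = max (norm z1) (norm z2)" by (rule char_roots)
  have "complex_of_real (fund b c (Suc (Suc t))) = z1 ^ Suc t + z2 * of_real (fund b c (Suc t))"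
    using fund_root[OF z, of "Suc t"] by (simp add: algebra_simps)
  then have "\<bar>fund b c (Suc (Suc t))\<bar> \<le> norm z1 ^ Suc t + norm z2 * \<bar>fund b c (Suc t)\<bar>"
    by (metis norm_triangle_ineq norm_mult norm_of_real norm_power)
  also have "\<dots> \<le> char_radius b c ^ Suc t + char_radius b c * (real (Suc t) * char_radius b c ^ t)"
    using Suc by (intro add_mono mult_mono power_mono) (auto simp: r le_max_iff_disj)
  finally show ?case by (simp add: algebra_simps)
qed simp

text \<open>By \<open>fund_root\<close> the power \<open>z1 ^ t\<close> is a fixed combination of
  two consecutive values of \<open>fund\<close>, so it cannot outgrow them. The roots enter
  symmetrically, so the same holds for \<open>z2\<close>.\<close>

lemma char_radius_le_growth:
  assumes "r > 0" and K: "\<And>t. \<bar>fund b c t\<bar> \<le> K * r ^ t"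
  shows "char_radius b c \<le> r"
proof -
  have "norm z1 \<le> r" if z: "z1 + z2 = complex_of_real b" "z1 * z2 = of_real c" for z1 z2
  proof (rule ccontr)
    assume "\<not> norm z1 \<le> r"
    then have "1 < norm z1 / r" using assms(1) by simp
    from real_arch_pow[OF this] obtain t where t: "K * r + norm z2 * K < (norm z1 / r) ^ t" by blast
    have "norm z1 ^ t = norm (complex_of_real (fund b c (Suc t)) - z2 * of_real (fund b c t))"
      unfolding fund_root[OF z] by (simp add: norm_power)
    also have "\<dots> \<le> \<bar>fund b c (Suc t)\<bar> + norm z2 * \<bar>fund b c t\<bar>"
      by (metis norm_triangle_ineq4 norm_mult norm_of_real)
    also have "\<dots> \<le> K * r ^ Suc t + norm z2 * (K * r ^ t)"
      by (intro add_mono mult_left_mono K) auto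
    also have "\<dots> = (K * r + norm z2 * K) * r ^ t" by (simp add: algebra_simps)
    finally have "(norm z1 / r) ^ t \<le> K * r + norm z2 * K"
      using assms(1) by (simp add: power_divide field_simps)
    with t show False by simp
  qed
  moreover obtain z1 z2 where z: "z1 + z2 = complex_of_real b" "z1 * z2 = of_real c"
    and "char_radius b c = max (norm z1) (norm z2)" by (rule char_roots)
  moreover have "z2 + z1 = complex_of_real b" "z2 * z1 = of_real c" using z by (simp_all add: ac_simps)
  ultimately show ?thesis by auto
qed

text \<open>The Jury conditions. Unlike \<open>char_radius\<close> they are convex in \<open>(b, c)\<close>.\<close>

lemma char_radius_le_iff:
  assumes "r > 0"
  shows "char_radius b c \<le> r \<longleftrightarrow> \<bar>c\<bar> \<le> r\<^sup>2 \<and> \<bar>b\<bar> * r \<le> r\<^sup>2 + c"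
proof (cases "b\<^sup>2 - 4 * c < 0")
  case True
  then have c: "c > 0" using zero_le_power2[of b] by linarith
  \<comment> \<open>For complex roots the second condition is automatic:
    \<open>\<bar>b\<bar> \<le> 2 * sqrt c\<close>, followed by the inequality of arithmetic and
    geometric means for \<open>r\<close> and \<open>sqrt c\<close>.\<close>
  have "\<bar>b\<bar> * r \<le> r\<^sup>2 + c"
  proof -
    have "\<bar>b\<bar>\<^sup>2 \<le> (2 * sqrt c)\<^sup>2" using True c by (simp add: power_mult_distrib)
    then have "\<bar>b\<bar> \<le> 2 * sqrt c" using power2_le_imp_le[of "\<bar>b\<bar>" "2 * sqrt c"] c by simp
    then have "\<bar>b\<bar> * r \<le> 2 * sqrt c * r" using assms by simp
    also have "\<dots> \<le> r\<^sup>2 + (sqrt c)\<^sup>2" using sum_squares_bound[of r "sqrt c"] by (simp add: ac_simps)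
    finally show ?thesis using c by simp
  qed
  moreover have "sqrt c \<le> r \<longleftrightarrow> \<bar>c\<bar> \<le> r\<^sup>2"
    using c assms by (auto simp: real_le_lsqrt sqrt_le_D)
  ultimately show ?thesis using True by (simp add: char_radius_def)
next
  case False
  define s where "s = sqrt (b\<^sup>2 - 4 * c)"
  have s: "s\<^sup>2 = b\<^sup>2 - 4 * c" "s \<ge> 0" using False by (simp_all add: s_def)
  have "char_radius b c \<le> r \<longleftrightarrow> s \<le> 2 * r - \<bar>b\<bar>"
    using False by (auto simp: char_radius_def s_def)
  also have "\<dots> \<longleftrightarrow> \<bar>b\<bar> \<le> 2 * r \<and> s\<^sup>2 \<le> (2 * r - \<bar>b\<bar>)\<^sup>2"
    using s(2) by (smt (verit) power2_le_imp_le power_mono)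
  also have "s\<^sup>2 \<le> (2 * r - \<bar>b\<bar>)\<^sup>2 \<longleftrightarrow> \<bar>b\<bar> * r \<le> r\<^sup>2 + c"
    unfolding s by (simp add: power2_diff power_mult_distrib) (auto simp: algebra_simps)
  \<comment> \<open>The sign condition left over from squaring is exchanged for the bound on
    \<open>c\<close>. In one direction this uses that the discriminant is nonnegative, that is
    \<open>4 * c \<le> b\<^sup>2\<close>.\<close>
  also have "\<bar>b\<bar> \<le> 2 * r \<and> \<bar>b\<bar> * r \<le> r\<^sup>2 + c \<longleftrightarrow> \<bar>c\<bar> \<le> r\<^sup>2 \<and> \<bar>b\<bar> * r \<le> r\<^sup>2 + c"
  proof safe
    assume b: "\<bar>b\<bar> \<le> 2 * r" and j: "\<bar>b\<bar> * r \<le> r\<^sup>2 + c"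
    have "\<bar>b\<bar>\<^sup>2 \<le> (2 * r)\<^sup>2" using b by (intro power_mono) auto
    then have "c \<le> r\<^sup>2" using False by (simp add: power_mult_distrib)
    moreover have "0 \<le> \<bar>b\<bar> * r" using assms by simp
    ultimately show "\<bar>c\<bar> \<le> r\<^sup>2" using j by linarith
  next
    assume c: "\<bar>c\<bar> \<le> r\<^sup>2" and j: "\<bar>b\<bar> * r \<le> r\<^sup>2 + c"
    then have "\<bar>b\<bar> * r \<le> (2 * r) * r" by (simp add: power2_eq_square)
    then show "\<bar>b\<bar> \<le> 2 * r" using assms by simp
  qed
  finally show ?thesis .
qed

lemma char_radius_less_one:
  assumes "char_radius b c < 1"
  shows "\<bar>c\<bar> < 1" "\<bar>b\<bar> < 1 + c"
proof -
  obtain r where r: "char_radius b c < r" "r < 1" using dense[OF assms] by blast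
  have r0: "r > 0" using r(1) char_radius_nonneg[of b c] by linarith
  have j: "\<bar>c\<bar> \<le> r\<^sup>2" "\<bar>b\<bar> * r \<le> r\<^sup>2 + c" using char_radius_le_iff[OF r0, of b c] r(1) by auto
  have "r\<^sup>2 < r" using r0 r(2) by (simp add: power2_eq_square)
  then show "\<bar>c\<bar> < 1" using j r(2) by linarith
  \<comment> \<open>The product equals \<open>(1 + c) * r - (r\<^sup>2 + c)\<close>; its positivity
    turns the weak Jury condition at \<open>r\<close> into the strict one at 1.\<close>
  have "0 < (1 - r) * (r - c)" using r(2) j \<open>r\<^sup>2 < r\<close> by (intro mult_pos_pos) auto
  then have "r\<^sup>2 + c < (1 + c) * r" by (simp add: algebra_simps power2_eq_square)
  then have "\<bar>b\<bar> * r < (1 + c) * r" using j by linarith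
  then show "\<bar>b\<bar> < 1 + c" using r0 by simp
qed

section \<open>Geometric bounds uniform in the coefficients\<close>

lemma poly_geometric_bound:
  assumes "0 < s" "s < (r::real)"
  obtains K where "K \<ge> 0" "\<And>t. real (Suc t) * s ^ t \<le> K * r ^ Suc t"
proof -
  have "(\<lambda>n. real n * (s / r) ^ n) \<longlonglongrightarrow> 0"
    using assms by (intro powser_times_n_limit_0) auto
  then have "Bseq (\<lambda>n. real n * (s / r) ^ n)" by (intro convergent_imp_Bseq convergentI)
  then obtain K where K: "K > 0" "\<And>n. \<bar>real n * (s / r) ^ n\<bar> \<le> K" by (auto simp: Bseq_def)
  show thesis
  proof (rule that[of "K / s"])
    fix t
    have "real (Suc t) * (s / r) ^ Suc t \<le> K" using K(2)[of "Suc t"] by linarith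
    then have "real (Suc t) * s ^ Suc t \<le> K * r ^ Suc t"
      using assms by (simp add: power_divide divide_le_eq)
    then show "real (Suc t) * s ^ t \<le> K / s * r ^ Suc t"
      using assms by (simp add: field_simps)
  qed (use K assms in auto)
qed

text \<open>The point is the order of quantifiers: \<open>K\<close> depends on \<open>R\<close> and
  \<open>r\<close> only, so it serves all modes of all quadratics at once.\<close>

lemma fund_geometric_bound:
  assumes "0 \<le> R" "R < r"
  obtains K where "K \<ge> 0" "\<And>b c t. char_radius b c \<le> R \<Longrightarrow> \<bar>fund b c t\<bar> \<le> K * r ^ t"
proof -
  \<comment> \<open>\<open>R\<close> may be 0, whereas \<open>poly_geometric_bound\<close> needs a
    positive base; \<open>s\<close> takes its place.\<close>
  obtain s where s: "R < s" "s < r" using dense[OF assms(2)] by blast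
  with assms have "0 < s" by linarith
  obtain K where K: "K \<ge> 0" "\<And>t. real (Suc t) * s ^ t \<le> K * r ^ Suc t"
    using poly_geometric_bound[OF \<open>0 < s\<close> s(2)] by metis
  have "\<bar>fund b c t\<bar> \<le> K * r ^ t" if "char_radius b c \<le> R" for b c t
  proof (cases t)
    case (Suc t')
    have "\<bar>fund b c (Suc t')\<bar> \<le> real (Suc t') * char_radius b c ^ t'" by (rule fund_bound)
    also have "\<dots> \<le> real (Suc t') * s ^ t'"
      using that s char_radius_nonneg by (intro mult_left_mono power_mono) auto
    also note K(2)
    finally show ?thesis using Suc by simp
  qed (use K in auto)
  with K(1) that show thesis by blast
qed

text \<open>Output of a mode \<open>Suc j\<close> steps after a unit pulse in its state equation;
  the factor \<open>- \<alpha>\<close> by which noise enters is left out.\<close>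

definition impulse :: "real \<Rightarrow> real \<Rightarrow> real \<Rightarrow> nat \<Rightarrow> real" where
  "impulse b c \<eta> j = (1 + \<eta>) * fund b c (Suc j) - \<eta> * fund b c j"

text \<open>The squared output is exactly the decrease of a quadratic form \<open>V\<close> along
  the recurrence. The energy therefore telescopes to the value of \<open>V\<close> at the start
  \<open>(1, 0)\<close>, which is \<open>P\<close>, since stability drives \<open>V\<close> to
  0.\<close>

lemma impulse_energy:
  assumes "char_radius b c < 1"
  shows "(\<lambda>j. (impulse b c \<eta> j)\<^sup>2) sums
    ((((1 + \<eta>)\<^sup>2 + \<eta>\<^sup>2) * (1 + c) - 2 * b * \<eta> * (1 + \<eta>)) / ((1 - c) * ((1 + c)\<^sup>2 - b\<^sup>2)))"
proof -
  note st = char_radius_less_one[OF assms]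
  have pos: "1 - c > 0" "1 + c > 0" using st by auto
  have "\<bar>b\<bar>\<^sup>2 < (1 + c)\<^sup>2" using st by (intro power_strict_mono) auto
  then have pos3: "(1 + c)\<^sup>2 - b\<^sup>2 > 0" by simp
  \<comment> \<open>\<open>V a p = P a\<^sup>2 + 2 Q a p + R p\<^sup>2\<close> solves the discrete Lyapunov equation of the recurrence\<close>
  define P where "P = (((1 + \<eta>)\<^sup>2 + \<eta>\<^sup>2) * (1 + c) - 2 * b * \<eta> * (1 + \<eta>)) / ((1 - c) * ((1 + c)\<^sup>2 - b\<^sup>2))"
  define Q where "Q = - (\<eta> * (1 + \<eta>) + P * b * c) / (1 + c)"
  define R where "R = P * c\<^sup>2 + \<eta>\<^sup>2"
  define V where "V a p = P * a\<^sup>2 + 2 * Q * a * p + R * p\<^sup>2" for a p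
  have P_eq: "P * ((1 - c) * ((1 + c)\<^sup>2 - b\<^sup>2)) = ((1 + \<eta>)\<^sup>2 + \<eta>\<^sup>2) * (1 + c) - 2 * b * \<eta> * (1 + \<eta>)"
    using pos pos3 by (simp add: P_def)
  have Q_eq: "Q * (1 + c) = - (\<eta> * (1 + \<eta>) + P * b * c)" using pos by (simp add: Q_def)
  \<comment> \<open>Comparing the coefficients of \<open>a * p\<close> and \<open>p\<^sup>2\<close>
    in the decrease of \<open>V\<close> determines \<open>Q\<close> and \<open>R\<close>. What
    remains is the coefficient of \<open>a\<^sup>2\<close>, an equation for \<open>P\<close> that
    its closed form solves; the factor \<open>1 + c\<close> clears the denominator of
    \<open>Q\<close>.\<close>
  have "(1 + c) * (P * b\<^sup>2 + 2 * Q * b + R - P + (1 + \<eta>)\<^sup>2) = 0"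
  proof -
    have "(1 + c) * (P * b\<^sup>2 + 2 * Q * b + R - P + (1 + \<eta>)\<^sup>2)
      = (1 + c) * (P * b\<^sup>2 + R - P + (1 + \<eta>)\<^sup>2) + 2 * b * (Q * (1 + c))" by algebra
    also have "\<dots> = 0" unfolding Q_eq R_def using P_eq by algebra
    finally show ?thesis .
  qed
  then have E1: "P * b\<^sup>2 + 2 * Q * b + R - P = - (1 + \<eta>)\<^sup>2" using pos by simp
  have step: "V (b * a - c * p) a - V a p = - ((1 + \<eta>) * a - \<eta> * p)\<^sup>2" for a p
  proof -
    have "V (b * a - c * p) a - V a p = (P * b\<^sup>2 + 2 * Q * b + R - P) * a\<^sup>2
       - 2 * (P * b * c + Q * (1 + c)) * a * p + (P * c\<^sup>2 - R) * p\<^sup>2"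
      unfolding V_def by algebra
    also have "\<dots> = - ((1 + \<eta>) * a - \<eta> * p)\<^sup>2" unfolding E1 Q_eq unfolding R_def by algebra
    finally show ?thesis .
  qed
  have sum: "(\<Sum>j<T. (impulse b c \<eta> j)\<^sup>2) = P - V (fund b c (Suc T)) (fund b c T)" for T
  proof (induction T)
    case (Suc T)
    then show ?case using step[of "fund b c (Suc T)" "fund b c T"] by (simp add: impulse_def)
  qed (simp add: V_def)
  obtain r where r: "char_radius b c < r" "r < 1" using dense[OF assms] by blast
  obtain K where K: "K \<ge> 0" "\<And>t. \<bar>fund b c t\<bar> \<le> K * r ^ t"
    using fund_geometric_bound[OF char_radius_nonneg r(1)] by (metis order_refl)
  have "(\<lambda>t. K * r ^ t) \<longlonglongrightarrow> 0"
    using r char_radius_nonneg[of b c] by (auto intro!: tendsto_mult_right_zero LIMSEQ_power_zero)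
  then have lim: "fund b c \<longlonglongrightarrow> 0"
    using K by (intro tendsto_rabs_zero_cancel[of "fund b c"] tendsto_sandwich[of "\<lambda>_. 0" "\<lambda>t. \<bar>fund b c t\<bar>" _ "\<lambda>t. K * r ^ t" 0]) auto
  then have "(\<lambda>T. P - V (fund b c (Suc T)) (fund b c T)) \<longlonglongrightarrow> P - V 0 0"
    unfolding V_def by (intro tendsto_intros LIMSEQ_Suc)
  then show ?thesis unfolding sums_def sum by (simp add: V_def P_def)
qed

section \<open>Modes of the iteration\<close>

text \<open>
  \<open>B\<close> is an eigenbasis of the Hessian of \<open>f\<close> and \<open>q e\<close> the eigenvalue of \<open>e\<close>; of orthonormality
  only Parseval's identity is ever needed.
\<close>

definition modal :: "(real^'d^1 \<Rightarrow> real) \<Rightarrow> (real^'d) set \<Rightarrow> (real^'d \<Rightarrow> real) \<Rightarrow> bool" where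
  "modal f B q \<longleftrightarrow> finite B \<and> (\<forall>v. (norm v)\<^sup>2 = (\<Sum>e\<in>B. (v \<bullet> e)\<^sup>2)) \<and>
     (\<forall>y. \<forall>e\<in>B. grad f y $ 1 \<bullet> e = q e * ((y - minimizer f) $ 1 \<bullet> e))"

lemma inner_vec_1: "x \<bullet> y = x $ 1 \<bullet> y $ 1" for x y :: "'a::real_inner^1"
  by (simp add: inner_vec_def)

lemma norm_vec_1: "norm x = norm (x $ 1)" for x :: "'a::real_inner^1"
  by (simp add: norm_vec_def L2_set_def)

lemma norm_power2_vec_2: "(norm x)\<^sup>2 = (norm (x $ 1))\<^sup>2 + (norm (x $ 2))\<^sup>2" for x :: "'a::real_inner^2"
  by (simp add: norm_vec_def L2_set_def sum_2)

section \<open>Gradients and minimizers of quadratics\<close>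

lemma grad_eqI:
  assumes "GDERIV f x :> D"
  shows "grad f x = D"
  unfolding grad_def
proof (rule the_equality)
  fix D' assume "GDERIV f x :> D'"
  then have "(\<lambda>h. h \<bullet> D') = (\<lambda>h. h \<bullet> D)"
    using assms has_derivative_unique unfolding gderiv_def by blast
  then have "\<forall>h. h \<bullet> D' = h \<bullet> D" by (intro allI) (rule fun_cong)
  then show "D' = D" by (rule vector_eq_ldot[THEN iffD1])
qed fact

lemma symmetric_matrix_self_adjoint:
  fixes Q :: "real^'n^'n"
  assumes "transpose Q = Q"
  shows "(Q *v x) \<bullet> y = x \<bullet> (Q *v y)"
  unfolding transpose_matrix_vector[of Q x, unfolded assms] by (rule dot_lmul_matrix)

lemma grad_quadratic:
  fixes Q :: "real^'d^'d"
  assumes "transpose Q = Q"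
  shows "grad (\<lambda>y :: real^'d^1. 1/2 * ((y - ys) $ 1 \<bullet> (Q *v (y - ys) $ 1)) + fs) y = (\<chi> i. Q *v (y - ys) $ 1)"
proof (rule grad_eqI)
  have G: "((\<lambda>y :: real^'d^1. (y - ys) $ 1) has_derivative (\<lambda>h. h $ 1)) (at y)"
  proof -
    have "((\<lambda>y :: real^'d^1. y $ 1 - ys $ 1) has_derivative (\<lambda>h. h $ 1 - 0)) (at y)"
      by (rule has_derivative_diff[OF bounded_linear_imp_has_derivative[OF bounded_linear_vec_nth] has_derivative_const])
    then show ?thesis by simp
  qed
  have "((\<lambda>y :: real^'d^1. 1/2 * ((y - ys) $ 1 \<bullet> (Q *v (y - ys) $ 1)) + fs) has_derivative
     (\<lambda>h. 1/2 * ((y - ys) $ 1 \<bullet> (Q *v h $ 1) + h $ 1 \<bullet> (Q *v (y - ys) $ 1)))) (at y)" (is "(?f has_derivative ?D) _")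
    by (intro has_derivative_add_const has_derivative_mult_right has_derivative_inner
        bounded_linear.has_derivative[OF matrix_vector_mul_bounded_linear] G)
  \<comment> \<open>Symmetry of \<open>Q\<close> makes the two halves of the product rule equal,
    which cancels the factor 1/2.\<close>
  moreover have "?D = (\<lambda>h. h \<bullet> (\<chi> i. Q *v (y - ys) $ 1))"
  proof
    fix h :: "real^'d^1"
    have "(y - ys) $ 1 \<bullet> (Q *v h $ 1) = h $ 1 \<bullet> (Q *v (y - ys) $ 1)"
      using symmetric_matrix_self_adjoint[OF assms, of "(y - ys) $ 1" "h $ 1"]
      by (simp only: inner_commute[of "h $ 1"])
    moreover have "1/2 * (a + a) = a" for a :: real by simp
    ultimately show "?D h = h \<bullet> (\<chi> i. Q *v (y - ys) $ 1)" by (simp only: inner_vec_1 vec_lambda_beta)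
  qed
  ultimately show "GDERIV ?f y :> (\<chi> i. Q *v (y - ys) $ 1)" by (simp only: gderiv_def)
qed

text \<open>The bound \<open>0 < m\<close> makes \<open>Q\<close> positive definite. This is what
  identifies \<open>minimizer f\<close>, a definite description, with the center
  \<open>ys\<close>.\<close>

lemma quad_class_modal:
  fixes f :: "real^'d^1 \<Rightarrow> real"
  assumes "f \<in> quad_class m L" "0 < m"
  obtains B q where "modal f B q" "\<And>e. e \<in> B \<Longrightarrow> m \<le> q e \<and> q e \<le> L"
proof -
  obtain fs ys Q where Q: "transpose Q = Q" "\<And>c. eigenvalue Q c \<Longrightarrow> m \<le> c \<and> c \<le> L"
    and f0: "f = (\<lambda>y. 1/2 * ((y - ys) ** Q ** transpose (y - ys)) $ 1 $ 1 + fs)"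
    using assms(1) unfolding quad_class_def by blast
  have "(x ** Q ** transpose x) $ 1 $ 1 = x $ 1 \<bullet> (Q *v x $ 1)" for x :: "real^'d^1"
  proof -
    have "(x ** Q) $ 1 $ j = (Q *v x $ 1) $ j" for j
    proof -
      have "Q $ k $ j = Q $ j $ k" for k using Q(1) by (simp add: transpose_def vec_eq_iff)
      then show ?thesis by (simp add: matrix_matrix_mult_def matrix_vector_mult_def ac_simps)
    qed
    then show ?thesis
      unfolding matrix_matrix_mult_def[of "x ** Q"] by (simp add: inner_vec_def transpose_def ac_simps)
  qed
  then have f: "f = (\<lambda>y. 1/2 * ((y - ys) $ 1 \<bullet> (Q *v (y - ys) $ 1)) + fs)" unfolding f0 by simp
  have sa: "(Q *v x) \<bullet> y = x \<bullet> (Q *v y)" for x y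
    by (rule symmetric_matrix_self_adjoint[OF Q(1)])
  obtain B q where B: "finite B" "\<forall>e\<in>B. norm e = 1 \<and> Q *v e = q e *\<^sub>R e"
    and parseval: "\<forall>x. (norm x)\<^sup>2 = (\<Sum>e\<in>B. (x \<bullet> e)\<^sup>2)"
    using self_adjoint_eigenbasis[of "(*v) Q" UNIV, OF matrix_vector_mul_linear sa] by auto
  have q: "m \<le> q e \<and> q e \<le> L" if "e \<in> B" for e
  proof (rule Q(2))
    show "eigenvalue Q (q e)" unfolding eigenvalue_def using B(2) that by (metis norm_zero zero_neq_one)
  qed
  have mode: "(Q *v v) \<bullet> e = q e * (v \<bullet> e)" if "e \<in> B" for v e
    using B(2) that by (simp add: sa)
  \<comment> \<open>Parseval is at hand only for norms, so the quadratic form is recovered from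
    norms by polarization.\<close>
  have polar: "v \<bullet> (Q *v v) = (\<Sum>e\<in>B. q e * (v \<bullet> e)\<^sup>2)" for v
  proof -
    have "4 * (v \<bullet> (Q *v v)) = (norm (v + Q *v v))\<^sup>2 - (norm (v - Q *v v))\<^sup>2"
      by (simp add: power2_norm_eq_inner inner_add_left inner_add_right inner_diff_left inner_diff_right inner_commute)
    also have "\<dots> = (\<Sum>e\<in>B. 4 * (q e * (v \<bullet> e)\<^sup>2))"
      unfolding parseval[rule_format] sum_subtractf[symmetric]
      by (intro sum.cong refl) (simp add: inner_add_left inner_diff_left mode power2_eq_square algebra_simps)
    finally show ?thesis by (simp add: sum_distrib_left[symmetric])
  qed
  have lower: "m * (norm v)\<^sup>2 \<le> v \<bullet> (Q *v v)" for v
    unfolding polar parseval[rule_format] sum_distrib_left using q by (intro sum_mono mult_right_mono) auto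
  have pos: "v \<bullet> (Q *v v) > 0" if "v \<noteq> 0" for v
  proof -
    have "0 < m * (norm v)\<^sup>2" using that assms(2) by simp
    also note lower
    finally show ?thesis .
  qed
  have "minimizer f = ys" unfolding minimizer_def
  proof (rule the_equality)
    show "\<forall>z. f ys \<le> f z"
    proof
      fix z show "f ys \<le> f z" using pos[of "(z - ys) $ 1"] by (cases "(z - ys) $ 1 = 0") (simp_all add: f)
    qed
    fix y assume y: "\<forall>z. f y \<le> f z"
    have "(y - ys) $ 1 = 0"
    proof (rule ccontr)
      assume "(y - ys) $ 1 \<noteq> 0"
      from pos[OF this] y[rule_format, of ys] show False by (simp add: f)
    qed
    then show "y = ys" by (simp add: vec_eq_iff)
  qed
  moreover have "grad f y = (\<chi> i. Q *v (y - ys) $ 1)" for y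
    unfolding f by (rule grad_quadratic[OF Q(1)])
  ultimately have "modal f B q"
    using B(1) parseval mode by (simp add: modal_def)
  with q that show thesis by blast
qed

text \<open>The witness for both lower bounds. Every mode has the same eigenvalue \<open>q\<close>,
  so any initial direction and any noise direction excites it fully; the minimizer 0 makes the fixed
  point 0.\<close>

lemma isotropic_quadratic:
  fixes m L q :: real
  assumes "0 < m" "m \<le> q" "q \<le> L"
  defines "f \<equiv> \<lambda>y :: real^'d^1. 1/2 * (y ** (q *\<^sub>R mat 1 :: real^'d^'d) ** transpose y) $ 1 $ 1"
  shows "f \<in> quad_class m L" "minimizer f = 0" "modal f Basis (\<lambda>_. q)"
proof -
  have Qv: "(q *\<^sub>R mat 1 :: real^'d^'d) *v v = q *\<^sub>R v" for v
    by (subst scaleR_matrix_vector_assoc[symmetric]) simp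
  have sym: "transpose (q *\<^sub>R mat 1 :: real^'d^'d) = q *\<^sub>R mat 1"
    by (auto simp: vec_eq_iff transpose_def mat_def)
  show "f \<in> quad_class m L" unfolding quad_class_def
    using assms sym by (auto simp: f_def eigenvalue_def Qv intro!: exI[of _ 0] exI[of _ "q *\<^sub>R mat 1 :: real^'d^'d"])
  have f: "f = (\<lambda>y. 1/2 * ((y - 0) $ 1 \<bullet> ((q *\<^sub>R mat 1 :: real^'d^'d) *v (y - 0) $ 1)) + 0)"
    unfolding Qv by (auto simp: f_def fun_eq_iff matrix_matrix_mult_def mat_def inner_vec_def transpose_def
      sum_distrib_left ac_simps if_distrib cong: if_cong)
  show min: "minimizer f = 0" unfolding minimizer_def
  proof (rule the_equality)
    show "\<forall>z. f 0 \<le> f z" using assms(1,2) unfolding f Qv by simp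
    fix y assume "\<forall>z. f y \<le> f z"
    then have "f y \<le> f 0" by blast
    then have "q * (y $ 1 \<bullet> y $ 1) \<le> 0" unfolding f Qv by simp
    moreover have "q > 0" using assms(1,2) by linarith
    ultimately have "y $ 1 \<bullet> y $ 1 \<le> 0" by (simp add: mult_le_0_iff)
    then have "y $ 1 \<bullet> y $ 1 = 0" by (rule antisym) (rule inner_ge_zero)
    then have "y $ 1 = 0" by (simp only: inner_eq_zero_iff)
    then show "y = 0" by (simp add: vec_eq_iff)
  qed
  have "grad f y = (\<chi> i. q *\<^sub>R y $ 1)" for y
    using grad_quadratic[OF sym, of 0 0 y] unfolding f[symmetric] unfolding Qv by simp
  moreover have "(norm v)\<^sup>2 = (\<Sum>e\<in>Basis. (v \<bullet> e)\<^sup>2)" for v :: "real^'d"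
    unfolding power2_norm_eq_inner by (subst euclidean_inner) (simp add: power2_eq_square)
  ultimately show "modal f Basis (\<lambda>_. q)" by (simp add: modal_def min)
qed

section \<open>Reduction to scalar recurrences\<close>

lemma state_three_param:
  fixes f :: "real^'d^1 \<Rightarrow> real"
  shows "state (three_param \<alpha> \<beta> \<eta>) f w \<xi>0 (Suc t) $ 1 =
      (1 + \<beta>) *\<^sub>R state (three_param \<alpha> \<beta> \<eta>) f w \<xi>0 t $ 1 - \<beta> *\<^sub>R state (three_param \<alpha> \<beta> \<eta>) f w \<xi>0 t $ 2
      - \<alpha> *\<^sub>R (grad f (sys_output (three_param \<alpha> \<beta> \<eta>) f w \<xi>0 t) $ 1 + w t $ 1)" (is ?A1)
    and "state (three_param \<alpha> \<beta> \<eta>) f w \<xi>0 (Suc t) $ 2 = state (three_param \<alpha> \<beta> \<eta>) f w \<xi>0 t $ 1" (is ?A2)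
    and "sys_output (three_param \<alpha> \<beta> \<eta>) f w \<xi>0 t $ 1 =
      (1 + \<eta>) *\<^sub>R state (three_param \<alpha> \<beta> \<eta>) f w \<xi>0 t $ 1 - \<eta> *\<^sub>R state (three_param \<alpha> \<beta> \<eta>) f w \<xi>0 t $ 2" (is ?A3)
proof -
  have "(matA (three_param \<alpha> \<beta> \<eta>) ** S + matB (three_param \<alpha> \<beta> \<eta>) ** G) $ 1 =
      (1 + \<beta>) *\<^sub>R S $ 1 - \<beta> *\<^sub>R S $ 2 - \<alpha> *\<^sub>R G $ 1"
    and "(matA (three_param \<alpha> \<beta> \<eta>) ** S + matB (three_param \<alpha> \<beta> \<eta>) ** G) $ 2 = S $ 1"
    and out: "(matC (three_param \<alpha> \<beta> \<eta>) ** S) $ 1 = (1 + \<eta>) *\<^sub>R S $ 1 - \<eta> *\<^sub>R S $ 2"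
    for S :: "real^'d^2" and G :: "real^'d^1"
    by (simp_all add: three_param_def matrix_matrix_mult_def vec_eq_iff sum_2)
  from this(1,2) show "?A1" "?A2"
    by (simp_all only: state.simps sys_output_def vector_add_component)
  show ?A3 unfolding sys_output_def by (rule out)
qed

text \<open>\<open>mode_b\<close> and \<open>mode_c\<close> are the trace and the determinant of the
  closed-loop matrix \<open>A + q B C\<close>, hence the coefficients of its characteristic
  polynomial.\<close>

definition mode_b :: "real \<Rightarrow> real \<Rightarrow> real \<Rightarrow> real \<Rightarrow> real" where
  "mode_b \<alpha> \<beta> \<eta> q = \<beta> + 1 - \<alpha> * q - \<alpha> * \<eta> * q"

definition mode_c :: "real \<Rightarrow> real \<Rightarrow> real \<Rightarrow> real \<Rightarrow> real" where
  "mode_c \<alpha> \<beta> \<eta> q = \<beta> - \<alpha> * \<eta> * q"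

definition mode_rho :: "real \<Rightarrow> real \<Rightarrow> real \<Rightarrow> real \<Rightarrow> real" where
  "mode_rho \<alpha> \<beta> \<eta> q = char_radius (mode_b \<alpha> \<beta> \<eta> q) (mode_c \<alpha> \<beta> \<eta> q)"

text \<open>In deviations from the minimizer no constant term survives: the state coefficients
  \<open>1 + \<beta>\<close> and \<open>- \<beta>\<close> sum to 1, and so do the output
  coefficients \<open>1 + \<eta>\<close> and \<open>- \<eta>\<close>.\<close>

lemma mode_recursion:
  fixes f :: "real^'d^1 \<Rightarrow> real" and \<alpha> \<beta> \<eta> :: real and w :: "nat \<Rightarrow> real^'d^1" and \<xi>0 :: "real^'d^2"
  assumes "modal f B q" "e \<in> B"
  defines "Z \<equiv> \<lambda>i t. (state (three_param \<alpha> \<beta> \<eta>) f w \<xi>0 t $ i - minimizer f $ 1) \<bullet> e"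
  shows "Z 1 (Suc t) = mode_b \<alpha> \<beta> \<eta> (q e) * Z 1 t - mode_c \<alpha> \<beta> \<eta> (q e) * Z 2 t - \<alpha> * (w t $ 1 \<bullet> e)"
    and "Z 2 (Suc t) = Z 1 t"
    and "(sys_output (three_param \<alpha> \<beta> \<eta>) f w \<xi>0 t - minimizer f) $ 1 \<bullet> e = (1 + \<eta>) * Z 1 t - \<eta> * Z 2 t"
proof -
  show out: "(sys_output (three_param \<alpha> \<beta> \<eta>) f w \<xi>0 t - minimizer f) $ 1 \<bullet> e = (1 + \<eta>) * Z 1 t - \<eta> * Z 2 t"
    by (simp add: Z_def state_three_param inner_diff_left algebra_simps)
  have g: "grad f (sys_output (three_param \<alpha> \<beta> \<eta>) f w \<xi>0 t) $ 1 \<bullet> e = q e * ((1 + \<eta>) * Z 1 t - \<eta> * Z 2 t)"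
    using assms(1,2) out by (simp add: modal_def)
  show "Z 2 (Suc t) = Z 1 t" by (simp add: Z_def state_three_param del: state.simps)
  show "Z 1 (Suc t) = mode_b \<alpha> \<beta> \<eta> (q e) * Z 1 t - mode_c \<alpha> \<beta> \<eta> (q e) * Z 2 t - \<alpha> * (w t $ 1 \<bullet> e)"
    unfolding Z_def state_three_param(1) inner_diff_left inner_add_left inner_scaleR_left g
    by (simp add: Z_def mode_b_def mode_c_def inner_diff_left algebra_simps)
qed

lemma homogeneous_solution:
  fixes Z W :: "nat \<Rightarrow> real"
  assumes "\<And>t. Z (Suc t) = b * Z t - c * W t" "\<And>t. W (Suc t) = Z t"
  shows "Z t = fund b c (Suc t) * Z 0 - c * fund b c t * W 0"
proof -
  have "Z t = fund b c (Suc t) * Z 0 - c * fund b c t * W 0 \<and>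
        Z (Suc t) = fund b c (Suc (Suc t)) * Z 0 - c * fund b c (Suc t) * W 0"
  proof (induction t)
    case (Suc t)
    have "Z (Suc (Suc t)) = b * Z (Suc t) - c * Z t" by (simp only: assms)
    moreover from Suc have A: "Z t = fund b c (Suc t) * Z 0 - c * fund b c t * W 0"
      and B: "Z (Suc t) = fund b c (Suc (Suc t)) * Z 0 - c * fund b c (Suc t) * W 0" by auto
    ultimately have "Z (Suc (Suc t)) = fund b c (Suc (Suc (Suc t))) * Z 0 - c * fund b c (Suc (Suc t)) * W 0"
      using fund.simps(3)[of b c t] fund.simps(3)[of b c "Suc t"] by algebra
    with B show ?case ..
  qed (simp add: assms)
  then show ?thesis ..
qed

text \<open>Superposition: subtracting the unforced solution with the same initial values leaves the
  convolution of the input with the impulse response. An input at time \<open>k\<close> is first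
  seen at time \<open>Suc k\<close>, whence the index \<open>t - Suc k\<close>.\<close>

lemma forced_solution:
  fixes Z W :: "nat \<Rightarrow> real"
  assumes "\<And>t. Z (Suc t) = b * Z t - c * W t - \<alpha> * u t" "\<And>t. W (Suc t) = Z t"
    and "\<And>t. Z' (Suc t) = b * Z' t - c * W' t" "\<And>t. W' (Suc t) = Z' t"
    and "Z 0 = Z' 0" "W 0 = W' 0"
  shows "(1 + \<eta>) * Z t - \<eta> * W t = (1 + \<eta>) * Z' t - \<eta> * W' t - \<alpha> * (\<Sum>k<t. impulse b c \<eta> (t - Suc k) * u k)"
proof -
  have "Z t = Z' t - \<alpha> * (\<Sum>k<t. fund b c (t - k) * u k) \<and>
        W t = W' t - \<alpha> * (\<Sum>k<t. fund b c (t - Suc k) * u k)"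
  proof (induction t)
    case (Suc t)
    have "fund b c (Suc t - k) = b * fund b c (t - k) - c * fund b c (t - Suc k)" if "k < t" for k
    proof -
      from that obtain j where "t = Suc (k + j)" using less_iff_Suc_add by blast
      then show ?thesis by (simp add: Suc_diff_le)
    qed
    then have "(\<Sum>k<t. fund b c (Suc t - k) * u k)
      = (\<Sum>k<t. b * (fund b c (t - k) * u k) - c * (fund b c (t - Suc k) * u k))"
      by (intro sum.cong refl) (simp add: left_diff_distrib)
    also have "\<dots> = b * (\<Sum>k<t. fund b c (t - k) * u k) - c * (\<Sum>k<t. fund b c (t - Suc k) * u k)"
      by (simp only: sum_subtractf sum_distrib_left)
    finally have "(\<Sum>k<Suc t. fund b c (Suc t - k) * u k)
      = b * (\<Sum>k<t. fund b c (t - k) * u k) - c * (\<Sum>k<t. fund b c (t - Suc k) * u k) + u t" by simp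
    then have "Z (Suc t) = Z' (Suc t) - \<alpha> * (\<Sum>k<Suc t. fund b c (Suc t - k) * u k)"
      using Suc assms(1)[of t] assms(3)[of t] by algebra
    \<comment> \<open>The additional summand \<open>k = t\<close> carries
      \<open>fund b c 0 = 0\<close>, so the sum is the one for \<open>Z t\<close>.\<close>
    moreover have "W (Suc t) = W' (Suc t) - \<alpha> * (\<Sum>k<Suc t. fund b c (Suc t - Suc k) * u k)"
      using Suc by (simp add: assms)
    ultimately show ?case ..
  qed (simp add: assms)
  moreover have "impulse b c \<eta> (t - Suc k) = (1 + \<eta>) * fund b c (t - k) - \<eta> * fund b c (t - Suc k)" if "k < t" for k
    using that by (simp add: impulse_def Suc_diff_Suc)
  then have "(\<Sum>k<t. impulse b c \<eta> (t - Suc k) * u k)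
      = (\<Sum>k<t. (1 + \<eta>) * (fund b c (t - k) * u k) - \<eta> * (fund b c (t - Suc k) * u k))"
    by (intro sum.cong refl) (simp add: left_diff_distrib)
  then have "(\<Sum>k<t. impulse b c \<eta> (t - Suc k) * u k)
      = (1 + \<eta>) * (\<Sum>k<t. fund b c (t - k) * u k) - \<eta> * (\<Sum>k<t. fund b c (t - Suc k) * u k)"
    by (simp only: sum_subtractf sum_distrib_left)
  ultimately show ?thesis by algebra
qed

section \<open>Domination of the growth rate by the endpoint eigenvalues\<close>

lemma between_convex_combination:
  fixes m L q :: real
  assumes "m \<le> q" "q \<le> L"
  obtains s t where "s \<ge> 0" "t \<ge> 0" "s + t = 1" "q = s * m + t * L"
proof -
  have "q \<in> closed_segment m L" using assms by (simp add: closed_segment_eq_real_ivl)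
  then obtain u where "0 \<le> u" "u \<le> 1" "q = (1 - u) *\<^sub>R m + u *\<^sub>R L" by (auto simp: closed_segment_def)
  with that[of "1 - u" u] show thesis by simp
qed

lemma mode_rho_quasiconvex:
  assumes "m \<le> q" "q \<le> L"
  shows "mode_rho \<alpha> \<beta> \<eta> q \<le> max (mode_rho \<alpha> \<beta> \<eta> m) (mode_rho \<alpha> \<beta> \<eta> L)"
\<comment> \<open>The Jury criterion requires \<open>r > 0\<close>, but the maximum of the two radii
  may be 0; the slack keeps \<open>r\<close> positive.\<close>
proof (rule field_le_epsilon)
  fix \<epsilon> :: real assume "\<epsilon> > 0"
  define r where "r = max (mode_rho \<alpha> \<beta> \<eta> m) (mode_rho \<alpha> \<beta> \<eta> L) + \<epsilon>"
  have "mode_rho \<alpha> \<beta> \<eta> m \<ge> 0" unfolding mode_rho_def by (rule char_radius_nonneg)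
  then have r: "r > 0" "mode_rho \<alpha> \<beta> \<eta> m \<le> r" "mode_rho \<alpha> \<beta> \<eta> L \<le> r"
    using \<open>\<epsilon> > 0\<close> by (auto simp: r_def)
  obtain s t where st: "s \<ge> 0" "t \<ge> 0" "s + t = 1" "q = s * m + t * L"
    using assms by (rule between_convex_combination)
  have b: "mode_b \<alpha> \<beta> \<eta> q = s * mode_b \<alpha> \<beta> \<eta> m + t * mode_b \<alpha> \<beta> \<eta> L"
    and c: "mode_c \<alpha> \<beta> \<eta> q = s * mode_c \<alpha> \<beta> \<eta> m + t * mode_c \<alpha> \<beta> \<eta> L"
    unfolding mode_b_def mode_c_def using st(3,4) by algebra+
  note jury = char_radius_le_iff[OF r(1)]
  have jm: "\<bar>mode_c \<alpha> \<beta> \<eta> m\<bar> \<le> r\<^sup>2" "\<bar>mode_b \<alpha> \<beta> \<eta> m\<bar> * r \<le> r\<^sup>2 + mode_c \<alpha> \<beta> \<eta> m"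
    and jL: "\<bar>mode_c \<alpha> \<beta> \<eta> L\<bar> \<le> r\<^sup>2" "\<bar>mode_b \<alpha> \<beta> \<eta> L\<bar> * r \<le> r\<^sup>2 + mode_c \<alpha> \<beta> \<eta> L"
    using r(2,3) unfolding mode_rho_def jury by auto
  have abs: "\<bar>s * x + t * y\<bar> \<le> s * \<bar>x\<bar> + t * \<bar>y\<bar>" for x y
    using abs_triangle_ineq[of "s * x" "t * y"] st(1,2) by (simp add: abs_mult)
  have avg: "s * x + t * x = x" for x using st(3) by (metis distrib_right mult_1)
  have "\<bar>mode_c \<alpha> \<beta> \<eta> q\<bar> \<le> s * \<bar>mode_c \<alpha> \<beta> \<eta> m\<bar> + t * \<bar>mode_c \<alpha> \<beta> \<eta> L\<bar>"
    unfolding c by (rule abs)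
  also have "\<dots> \<le> s * r\<^sup>2 + t * r\<^sup>2" by (intro add_mono mult_left_mono jm jL st)
  finally have 1: "\<bar>mode_c \<alpha> \<beta> \<eta> q\<bar> \<le> r\<^sup>2" unfolding avg .
  have "\<bar>mode_b \<alpha> \<beta> \<eta> q\<bar> \<le> s * \<bar>mode_b \<alpha> \<beta> \<eta> m\<bar> + t * \<bar>mode_b \<alpha> \<beta> \<eta> L\<bar>"
    unfolding b by (rule abs)
  then have "\<bar>mode_b \<alpha> \<beta> \<eta> q\<bar> * r \<le> (s * \<bar>mode_b \<alpha> \<beta> \<eta> m\<bar> + t * \<bar>mode_b \<alpha> \<beta> \<eta> L\<bar>) * r"
    using r(1) by simp
  also have "\<dots> = s * (\<bar>mode_b \<alpha> \<beta> \<eta> m\<bar> * r) + t * (\<bar>mode_b \<alpha> \<beta> \<eta> L\<bar> * r)" by algebra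
  also have "\<dots> \<le> s * (r\<^sup>2 + mode_c \<alpha> \<beta> \<eta> m) + t * (r\<^sup>2 + mode_c \<alpha> \<beta> \<eta> L)"
    by (intro add_mono mult_left_mono jm jL st)
  also have "\<dots> = (s * r\<^sup>2 + t * r\<^sup>2) + mode_c \<alpha> \<beta> \<eta> q" unfolding c by algebra
  finally have 2: "\<bar>mode_b \<alpha> \<beta> \<eta> q\<bar> * r \<le> r\<^sup>2 + mode_c \<alpha> \<beta> \<eta> q" unfolding avg .
  have "mode_rho \<alpha> \<beta> \<eta> q \<le> r" unfolding mode_rho_def jury using 1 2 by blast
  then show "mode_rho \<alpha> \<beta> \<eta> q \<le> max (mode_rho \<alpha> \<beta> \<eta> m) (mode_rho \<alpha> \<beta> \<eta> L) + \<epsilon>"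
    using r_def by blast
qed

section \<open>The convergence rate\<close>

text \<open>Squares are estimated because they add up over the modes by Parseval. The factor
  \<open>r + r\<^sup>2\<close> dominates both the shift in \<open>fund b c (Suc t)\<close> and the
  coefficient \<open>c\<close>, for which the Jury bound
  \<open>\<bar>c\<bar> \<le> r\<^sup>2\<close> is used.\<close>

lemma homogeneous_bound:
  fixes Z W :: "nat \<Rightarrow> real"
  assumes rec: "\<And>t. Z (Suc t) = b * Z t - c * W t" "\<And>t. W (Suc t) = Z t"
    and r: "r > 0" "\<bar>c\<bar> \<le> r\<^sup>2" and K: "\<And>t. \<bar>fund b c t\<bar> \<le> K * r ^ t"
  shows "(Z t)\<^sup>2 + (W t)\<^sup>2 \<le> (2 * (K * (r + r\<^sup>2))\<^sup>2 * (1 + 1 / r\<^sup>2) + 1) * (r ^ t)\<^sup>2 * ((Z 0)\<^sup>2 + (W 0)\<^sup>2)"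
proof -
  define N where "N = (Z 0)\<^sup>2 + (W 0)\<^sup>2"
  define k where "k = K * (r + r\<^sup>2)"
  have K0: "K \<ge> 0" using K[of 0] by simp
  have k0: "k \<ge> 0" using K0 r by (simp add: k_def)
  have N0: "N \<ge> 0" by (simp add: N_def)
  have Z: "(Z t)\<^sup>2 \<le> 2 * k\<^sup>2 * (r ^ t)\<^sup>2 * N" for t
  proof -
    have "\<bar>Z t\<bar> \<le> \<bar>fund b c (Suc t)\<bar> * \<bar>Z 0\<bar> + \<bar>c\<bar> * \<bar>fund b c t\<bar> * \<bar>W 0\<bar>"
      unfolding homogeneous_solution[where Z = Z and W = W and t = t, OF rec]
      by (rule order_trans[OF abs_triangle_ineq4]) (simp add: abs_mult)
    also have "\<dots> \<le> (K * r ^ Suc t) * \<bar>Z 0\<bar> + (r\<^sup>2 * (K * r ^ t)) * \<bar>W 0\<bar>"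
      by (intro add_mono mult_right_mono mult_mono K r) auto
    also have "\<dots> = K * r * r ^ t * \<bar>Z 0\<bar> + K * r\<^sup>2 * r ^ t * \<bar>W 0\<bar>" by simp
    also have "\<dots> \<le> k * r ^ t * \<bar>Z 0\<bar> + k * r ^ t * \<bar>W 0\<bar>"
      using K0 r by (intro add_mono mult_right_mono) (auto simp: k_def algebra_simps)
    also have "\<dots> = k * r ^ t * (\<bar>Z 0\<bar> + \<bar>W 0\<bar>)" by (simp add: algebra_simps)
    finally have "\<bar>Z t\<bar>\<^sup>2 \<le> (k * r ^ t * (\<bar>Z 0\<bar> + \<bar>W 0\<bar>))\<^sup>2" by (intro power_mono) auto
    also have "\<dots> = (k * r ^ t)\<^sup>2 * (\<bar>Z 0\<bar> + \<bar>W 0\<bar>)\<^sup>2" by (rule power_mult_distrib)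
    also have "\<dots> \<le> (k * r ^ t)\<^sup>2 * (2 * N)"
    proof (rule mult_left_mono)
      show "(\<bar>Z 0\<bar> + \<bar>W 0\<bar>)\<^sup>2 \<le> 2 * N"
        using sum_squares_bound[of "\<bar>Z 0\<bar>" "\<bar>W 0\<bar>"] by (simp add: N_def power2_sum)
    qed simp
    finally show ?thesis by (simp add: power_mult_distrib ac_simps)
  qed
  \<comment> \<open>\<open>W\<close> is \<open>Z\<close> delayed by one step, which costs
    \<open>1 / r\<^sup>2\<close>; the summand 1 covers \<open>W 0\<close>, which has no
    predecessor.\<close>
  have W: "(W t)\<^sup>2 \<le> (2 * k\<^sup>2 / r\<^sup>2 + 1) * (r ^ t)\<^sup>2 * N"
  proof (cases t)
    case 0
    have "(W 0)\<^sup>2 \<le> 1 * N" by (simp add: N_def)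
    also have "\<dots> \<le> (2 * k\<^sup>2 / r\<^sup>2 + 1) * N" using N0 by (intro mult_right_mono) auto
    finally show ?thesis using 0 by simp
  next
    case (Suc s)
    have "(W t)\<^sup>2 \<le> 2 * k\<^sup>2 * (r ^ s)\<^sup>2 * N" using Z[of s] Suc rec by simp
    also have "\<dots> = 2 * k\<^sup>2 / r\<^sup>2 * (r ^ t)\<^sup>2 * N" using Suc r by (simp add: power_mult_distrib)
    also have "\<dots> \<le> (2 * k\<^sup>2 / r\<^sup>2 + 1) * (r ^ t)\<^sup>2 * N" using N0 by (intro mult_right_mono) auto
    finally show ?thesis .
  qed
  have "(Z t)\<^sup>2 + (W t)\<^sup>2 \<le> 2 * k\<^sup>2 * (r ^ t)\<^sup>2 * N + (2 * k\<^sup>2 / r\<^sup>2 + 1) * (r ^ t)\<^sup>2 * N"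
    by (intro add_mono Z W)
  also have "\<dots> = (2 * k\<^sup>2 * (1 + 1 / r\<^sup>2) + 1) * (r ^ t)\<^sup>2 * N" by (simp add: algebra_simps)
  finally show ?thesis by (simp add: N_def k_def)
qed

lemma norm_power2_modal:
  fixes x :: "real^'d^2"
  assumes "modal f B q"
  shows "(norm (x - vector [v, v]))\<^sup>2 = (\<Sum>e\<in>B. ((x $ 1 - v) \<bullet> e)\<^sup>2 + ((x $ 2 - v) \<bullet> e)\<^sup>2)"
  using assms unfolding modal_def norm_power2_vec_2 by (simp add: sum.distrib)

text \<open>\<open>M\<close> is fixed before the function, its eigenbasis, the initial state and the
  time are chosen, as finiteness of the nested suprema in \<open>rate\<close> demands.\<close>

lemma state_geometric_bound:
  fixes \<alpha> \<beta> \<eta> :: real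
  assumes "0 \<le> R" "R < r"
  obtains M where "\<And>(f :: real^'d^1 \<Rightarrow> real) B q \<xi>0 t.
    modal f B q \<Longrightarrow> \<forall>e\<in>B. mode_rho \<alpha> \<beta> \<eta> (q e) \<le> R \<Longrightarrow>
    (norm (state (three_param \<alpha> \<beta> \<eta>) f (\<lambda>_. 0) \<xi>0 t - vector [minimizer f $ 1, minimizer f $ 1]))\<^sup>2
      \<le> M * (r ^ t)\<^sup>2 * (norm (\<xi>0 - vector [minimizer f $ 1, minimizer f $ 1]))\<^sup>2"
proof -
  obtain K where K: "\<And>b c t. char_radius b c \<le> R \<Longrightarrow> \<bar>fund b c t\<bar> \<le> K * r ^ t"
    using fund_geometric_bound[OF assms] by metis
  have r: "r > 0" using assms by simp
  show thesis
  proof (rule that)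
    fix f :: "real^'d^1 \<Rightarrow> real" and B q \<xi>0 t
    assume f: "modal f B q" and q: "\<forall>e\<in>B. mode_rho \<alpha> \<beta> \<eta> (q e) \<le> R"
    let ?S = "state (three_param \<alpha> \<beta> \<eta>) f (\<lambda>_. 0) \<xi>0"
    let ?M = "2 * (K * (r + r\<^sup>2))\<^sup>2 * (1 + 1 / r\<^sup>2) + 1"
    define Z where "Z i e t = (?S t $ i - minimizer f $ 1) \<bullet> e" for i :: 2 and e t
    have "(Z 1 e t)\<^sup>2 + (Z 2 e t)\<^sup>2 \<le> ?M * (r ^ t)\<^sup>2 * ((Z 1 e 0)\<^sup>2 + (Z 2 e 0)\<^sup>2)" if "e \<in> B" for e
    proof (rule homogeneous_bound[where b = "mode_b \<alpha> \<beta> \<eta> (q e)" and c = "mode_c \<alpha> \<beta> \<eta> (q e)"])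
      fix t
      show "Z 1 e (Suc t) = mode_b \<alpha> \<beta> \<eta> (q e) * Z 1 e t - mode_c \<alpha> \<beta> \<eta> (q e) * Z 2 e t"
        using mode_recursion(1)[OF f that, of \<alpha> \<beta> \<eta> "\<lambda>_. 0" \<xi>0 t] unfolding Z_def by simp
      show "Z 2 e (Suc t) = Z 1 e t"
        using mode_recursion(2)[OF f that, of \<alpha> \<beta> \<eta> "\<lambda>_. 0" \<xi>0 t] unfolding Z_def .
      have rho: "char_radius (mode_b \<alpha> \<beta> \<eta> (q e)) (mode_c \<alpha> \<beta> \<eta> (q e)) \<le> R"
        using q that by (simp add: mode_rho_def)
      then show "\<bar>fund (mode_b \<alpha> \<beta> \<eta> (q e)) (mode_c \<alpha> \<beta> \<eta> (q e)) t\<bar> \<le> K * r ^ t" by (rule K)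
      have "char_radius (mode_b \<alpha> \<beta> \<eta> (q e)) (mode_c \<alpha> \<beta> \<eta> (q e)) \<le> r"
        using rho assms(2) by linarith
      then show "\<bar>mode_c \<alpha> \<beta> \<eta> (q e)\<bar> \<le> r\<^sup>2" by (simp only: char_radius_le_iff[OF r])
    qed (rule r)
    then have "(\<Sum>e\<in>B. (Z 1 e t)\<^sup>2 + (Z 2 e t)\<^sup>2) \<le> (\<Sum>e\<in>B. ?M * (r ^ t)\<^sup>2 * ((Z 1 e 0)\<^sup>2 + (Z 2 e 0)\<^sup>2))"
      by (rule sum_mono)
    then show "(norm (?S t - vector [minimizer f $ 1, minimizer f $ 1]))\<^sup>2
        \<le> ?M * (r ^ t)\<^sup>2 * (norm (\<xi>0 - vector [minimizer f $ 1, minimizer f $ 1]))\<^sup>2"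
      unfolding norm_power2_modal[OF f] sum_distrib_left[symmetric] by (simp add: Z_def)
  qed
qed

lemma state_zero_fixed:
  fixes f :: "real^'d^1 \<Rightarrow> real"
  assumes "modal f B q" "minimizer f = 0"
  shows "state (three_param \<alpha> \<beta> \<eta>) f (\<lambda>_. 0) 0 t = 0"
proof -
  have "\<forall>e\<in>B. grad f 0 $ 1 \<bullet> e = 0" using assms by (simp add: modal_def)
  moreover have "(norm (grad f 0 $ 1))\<^sup>2 = (\<Sum>e\<in>B. (grad f 0 $ 1 \<bullet> e)\<^sup>2)"
    using assms(1) unfolding modal_def by blast
  ultimately have "(norm (grad f 0 $ 1))\<^sup>2 = 0" by simp
  then have "grad f 0 = 0" by (simp add: vec_eq_iff)
  then show ?thesis by (induction t) simp_all
qed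

text \<open>A growth bound on all trajectories bounds in particular the one whose
  \<open>e\<close>-component runs through the fundamental solution, and
  \<open>char_radius_le_growth\<close> applies to that.\<close>

lemma mode_rho_le_of_growth:
  fixes f :: "real^'d^1 \<Rightarrow> real"
  assumes f: "modal f B q" "minimizer f = 0" "e \<in> B" "e \<noteq> 0" and r: "r > 0"
    and K: "\<And>\<xi>0 t. norm (state (three_param \<alpha> \<beta> \<eta>) f (\<lambda>_. 0) \<xi>0 t) \<le> K * r ^ t * norm \<xi>0"
  shows "mode_rho \<alpha> \<beta> \<eta> (q e) \<le> r"
proof -
  let ?b = "mode_b \<alpha> \<beta> \<eta> (q e)" and ?c = "mode_c \<alpha> \<beta> \<eta> (q e)"
  \<comment> \<open>Current iterate \<open>e\<close>, previous iterate 0: the mode starts with the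
    values of \<open>fund\<close> at indices 1 and 0, scaled by
    \<open>e \<bullet> e\<close>.\<close>
  define \<xi>0 :: "real^'d^2" where "\<xi>0 = vector [e, 0]"
  let ?S = "state (three_param \<alpha> \<beta> \<eta>) f (\<lambda>_. 0) \<xi>0"
  have fund: "fund ?b ?c (Suc t) * (e \<bullet> e) = ?S t $ 1 \<bullet> e" for t
  proof -
    have "?S t $ 1 \<bullet> e = fund ?b ?c (Suc t) * (?S 0 $ 1 \<bullet> e) - ?c * fund ?b ?c t * (?S 0 $ 2 \<bullet> e)"
    proof (rule homogeneous_solution)
      fix t
      show "?S (Suc t) $ 1 \<bullet> e = ?b * (?S t $ 1 \<bullet> e) - ?c * (?S t $ 2 \<bullet> e)"
        using mode_recursion(1)[OF f(1,3), of \<alpha> \<beta> \<eta> "\<lambda>_. 0" \<xi>0 t] f(2) by (simp del: state.simps)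
      show "?S (Suc t) $ 2 \<bullet> e = ?S t $ 1 \<bullet> e"
        by (simp only: state_three_param(2))
    qed
    then show ?thesis by (simp add: \<xi>0_def)
  qed
  have base: "\<bar>fund ?b ?c (Suc t)\<bar> \<le> K * r ^ t * (norm \<xi>0 / norm e)" for t
  proof -
    have "\<bar>fund ?b ?c (Suc t)\<bar> * (e \<bullet> e) = \<bar>?S t $ 1 \<bullet> e\<bar>" by (simp add: fund[symmetric] abs_mult)
    also have "\<dots> \<le> norm (?S t $ 1) * norm e" by (rule Cauchy_Schwarz_ineq2)
    also have "\<dots> \<le> norm (?S t) * norm e" by (intro mult_right_mono Finite_Cartesian_Product.norm_nth_le) auto
    also have "\<dots> \<le> K * r ^ t * norm \<xi>0 * norm e" by (intro mult_right_mono K) auto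
    finally show ?thesis
      using f(4) by (simp add: dot_square_norm power2_eq_square field_simps)
  qed
  have step: "\<bar>fund ?b ?c (Suc t)\<bar> \<le> \<bar>K\<bar> * (norm \<xi>0 / norm e) / r * r ^ Suc t" for t
  proof -
    have "K * r ^ t * (norm \<xi>0 / norm e) \<le> \<bar>K\<bar> * r ^ t * (norm \<xi>0 / norm e)"
      using r by (intro mult_right_mono) auto
    also have "\<dots> = \<bar>K\<bar> * (norm \<xi>0 / norm e) / r * r ^ Suc t" using r by simp
    finally show ?thesis using base[of t] by linarith
  qed
  \<comment> \<open>The trajectory shows \<open>fund\<close> only from index 1 on; at index 0 it is
    0.\<close>
  have "\<bar>fund ?b ?c t\<bar> \<le> \<bar>K\<bar> * (norm \<xi>0 / norm e) / r * r ^ t" for t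
    using step r by (cases t) auto
  from char_radius_le_growth[OF r this] show ?thesis unfolding mode_rho_def .
qed

text \<open>Every \<open>r\<close> above the larger endpoint radius is admissible by the uniform
  state bound. Conversely, an admissible \<open>r\<close> bounds the trajectories of the isotropic
  quadratics with eigenvalues \<open>m\<close> and \<open>L\<close>, and hence both radii.\<close>

lemma rate_three_param:
  assumes "0 < m" "m \<le> L"
  shows "rate (three_param \<alpha> \<beta> \<eta>) (quad_class m L :: (real^'d^1 \<Rightarrow> real) set)
    = ereal (max (mode_rho \<alpha> \<beta> \<eta> m) (mode_rho \<alpha> \<beta> \<eta> L))" (is "?rate = ereal ?R")
proof (rule antisym)
  let ?A = "three_param \<alpha> \<beta> \<eta>"
  let ?\<xi> = "\<lambda>f :: real^'d^1 \<Rightarrow> real. vector [minimizer f $ 1, minimizer f $ 1] :: real^'d^2"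
  have R0: "0 \<le> ?R" unfolding mode_rho_def by (simp add: le_max_iff_disj char_radius_nonneg)
  show "?rate \<le> ereal ?R"
  proof (rule ccontr)
    assume "\<not> ?rate \<le> ereal ?R"
    then have "ereal ?R < ?rate" by (simp only: not_le)
    \<comment> \<open>At \<open>?R\<close> itself a double root can make the supremum infinite, so
      admissibility is shown only for \<open>r\<close> strictly above it.\<close>
    from ereal_dense2[OF this] obtain r where "ereal ?R < ereal r" and r2: "ereal r < ?rate" by blast
    then have r: "?R < r" by (simp only: less_ereal.simps)
    then have r0: "r > 0" using R0 by linarith
    obtain M where M: "\<And>(f :: real^'d^1 \<Rightarrow> real) B q \<xi>0 t.
      modal f B q \<Longrightarrow> \<forall>e\<in>B. mode_rho \<alpha> \<beta> \<eta> (q e) \<le> ?R \<Longrightarrow>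
      (norm (state ?A f (\<lambda>_. 0) \<xi>0 t - ?\<xi> f))\<^sup>2 \<le> M * (r ^ t)\<^sup>2 * (norm (\<xi>0 - ?\<xi> f))\<^sup>2"
      using state_geometric_bound[OF R0 r] by metis
    have "(SUP f\<in>(quad_class m L :: (real^'d^1 \<Rightarrow> real) set). SUP \<xi>s\<in>fixed_points ?A f. SUP \<xi>0. SUP t.
        ereal (norm (state ?A f (\<lambda>_. 0) \<xi>0 t - \<xi>s) / (r ^ t * norm (\<xi>0 - \<xi>s)))) \<le> ereal (sqrt \<bar>M\<bar>)"
    proof (intro SUP_least)
      fix f :: "real^'d^1 \<Rightarrow> real" and \<xi>s \<xi>0 t
      assume f: "f \<in> quad_class m L" and "\<xi>s \<in> fixed_points ?A f"
      then have \<xi>s: "\<xi>s = ?\<xi> f" by (simp add: fixed_points_three_param)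
      obtain B q where Bq: "modal f B q" "\<And>e. e \<in> B \<Longrightarrow> m \<le> q e \<and> q e \<le> L"
        using quad_class_modal[OF f assms(1)] by metis
      have "\<forall>e\<in>B. mode_rho \<alpha> \<beta> \<eta> (q e) \<le> ?R" using Bq(2) mode_rho_quasiconvex by metis
      then have "(norm (state ?A f (\<lambda>_. 0) \<xi>0 t - \<xi>s))\<^sup>2 \<le> M * (r ^ t)\<^sup>2 * (norm (\<xi>0 - \<xi>s))\<^sup>2"
        unfolding \<xi>s by (rule M[OF Bq(1)])
      also have "\<dots> \<le> \<bar>M\<bar> * (r ^ t)\<^sup>2 * (norm (\<xi>0 - \<xi>s))\<^sup>2" by (intro mult_right_mono) auto
      also have "\<dots> = (sqrt \<bar>M\<bar> * (r ^ t * norm (\<xi>0 - \<xi>s)))\<^sup>2" by (simp add: power_mult_distrib)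
      finally have "norm (state ?A f (\<lambda>_. 0) \<xi>0 t - \<xi>s) \<le> sqrt \<bar>M\<bar> * (r ^ t * norm (\<xi>0 - \<xi>s))"
        by (rule power2_le_imp_le) (use r0 in simp)
      then have "norm (state ?A f (\<lambda>_. 0) \<xi>0 t - \<xi>s) / (r ^ t * norm (\<xi>0 - \<xi>s)) \<le> sqrt \<bar>M\<bar>"
        using r0 by (cases "\<xi>0 = \<xi>s") (auto simp: divide_le_eq)
      then show "ereal (norm (state ?A f (\<lambda>_. 0) \<xi>0 t - \<xi>s) / (r ^ t * norm (\<xi>0 - \<xi>s))) \<le> ereal (sqrt \<bar>M\<bar>)"
        by simp
    qed
    also have "\<dots> < \<infinity>" by simp
    finally have "?rate \<le> ereal r" unfolding rate_def using r0 by (intro INF_lower) simp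
    with r2 show False by simp
  qed
  show "ereal ?R \<le> ?rate" unfolding rate_def
  proof (rule INF_greatest, clarify)
    fix r :: real assume r: "0 < r"
      and fin: "(SUP f\<in>(quad_class m L :: (real^'d^1 \<Rightarrow> real) set). SUP \<xi>s\<in>fixed_points ?A f. SUP \<xi>0. SUP t.
        ereal (norm (state ?A f (\<lambda>_. 0) \<xi>0 t - \<xi>s) / (r ^ t * norm (\<xi>0 - \<xi>s)))) < \<infinity>" (is "?sup < \<infinity>")
    obtain n :: nat where "?sup < ereal (real n)" using less_PInf_Ex_of_nat fin by auto
    then have n: "?sup \<le> ereal (real n)" by simp
    have K: "norm (state ?A f (\<lambda>_. 0) \<xi>0 t - ?\<xi> f) / (r ^ t * norm (\<xi>0 - ?\<xi> f)) \<le> real n"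
      if "f \<in> quad_class m L" for f :: "real^'d^1 \<Rightarrow> real" and \<xi>0 t
    proof -
      have "ereal (norm (state ?A f (\<lambda>_. 0) \<xi>0 t - ?\<xi> f) / (r ^ t * norm (\<xi>0 - ?\<xi> f))) \<le> ?sup"
        by (rule SUP_upper2[where i = f], rule that, rule SUP_upper2[where i = "?\<xi> f"],
            simp add: fixed_points_three_param, rule SUP_upper2[where i = \<xi>0], rule UNIV_I,
            rule SUP_upper2[where i = t], rule UNIV_I, rule order_refl)
      with n show ?thesis using order_trans ereal_less_eq(3) by blast
    qed
    have "mode_rho \<alpha> \<beta> \<eta> q \<le> r" if q: "m \<le> q" "q \<le> L" for q
    proof -
      obtain f :: "real^'d^1 \<Rightarrow> real" where f: "f \<in> quad_class m L" "minimizer f = 0" "modal f Basis (\<lambda>_. q)"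
        using isotropic_quadratic[OF assms(1) q] by blast
      have \<xi>: "?\<xi> f = 0" using f(2) by (simp add: vec_eq_iff forall_2)
      obtain e :: "real^'d" where e: "e \<in> Basis" using nonempty_Basis by blast
      have "norm (state ?A f (\<lambda>_. 0) \<xi>0 t) \<le> real n * r ^ t * norm \<xi>0" for \<xi>0 t
      \<comment> \<open>The quotient at the fixed point is 0 by convention and says nothing there;
        instead, the trajectory stays at 0.\<close>
      proof (cases "\<xi>0 = 0")
        case True
        have "(norm (state ?A f (\<lambda>_. 0) \<xi>0 t))\<^sup>2 \<le> 0"
          using state_zero_fixed[OF f(3,2), of \<alpha> \<beta> \<eta> t] True by simp
        then show ?thesis using True by simp
      next
        case False
        then show ?thesis using K[OF f(1), of \<xi>0 t] \<xi> r by (simp add: divide_le_eq ac_simps)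
      qed
      from mode_rho_le_of_growth[OF f(3,2) e nonzero_Basis[OF e] r this]
      show ?thesis .
    qed
    then show "ereal ?R \<le> ereal r" using assms by simp
  qed
qed

section \<open>The noise gain of a mode\<close>

text \<open>The squared H2 norm of a mode from noise to output: the stationary output power per unit
  of noise power.\<close>

definition noise_gain :: "real \<Rightarrow> real \<Rightarrow> real \<Rightarrow> real \<Rightarrow> real" where
  "noise_gain \<alpha> \<beta> \<eta> q = \<alpha> * (1 + \<beta> + (1 + 2 * \<eta>) * \<alpha> * \<eta> * q) /
     (q * (1 - \<beta> + \<alpha> * \<eta> * q) * (2 + 2 * \<beta> - (1 + 2 * \<eta>) * \<alpha> * q))"

definition mode_impulse :: "real \<Rightarrow> real \<Rightarrow> real \<Rightarrow> real \<Rightarrow> nat \<Rightarrow> real" where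
  "mode_impulse \<alpha> \<beta> \<eta> q j = \<alpha> * impulse (mode_b \<alpha> \<beta> \<eta> q) (mode_c \<alpha> \<beta> \<eta> q) \<eta> j"

text \<open>These are the strict Jury conditions factor by factor: with \<open>b\<close> and
  \<open>c\<close> the coefficients of the mode, \<open>\<alpha> * q = 1 + c - b\<close>, and the
  other two expressions are \<open>1 - c\<close> and \<open>1 + c + b\<close>.\<close>

lemma stable_mode:
  assumes "0 < q" "mode_rho \<alpha> \<beta> \<eta> q < 1"
  shows "\<alpha> > 0" "1 - \<beta> + \<alpha> * \<eta> * q > 0" "2 + 2 * \<beta> - (1 + 2 * \<eta>) * \<alpha> * q > 0"
proof -
  note st = char_radius_less_one[OF assms(2)[unfolded mode_rho_def]]
  have "\<alpha> * q > 0" using st(2) by (simp add: mode_b_def mode_c_def)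
  then show "\<alpha> > 0" using assms(1) by (simp add: zero_less_mult_iff)
  show "1 - \<beta> + \<alpha> * \<eta> * q > 0" using st(1) by (simp add: mode_c_def)
  have "mode_b \<alpha> \<beta> \<eta> q + 1 + mode_c \<alpha> \<beta> \<eta> q > 0" using st(2) by linarith
  then show "2 + 2 * \<beta> - (1 + 2 * \<eta>) * \<alpha> * q > 0" by (simp add: mode_b_def mode_c_def algebra_simps)
qed

lemma mode_impulse_energy:
  assumes "0 < q" "mode_rho \<alpha> \<beta> \<eta> q < 1"
  shows "(\<lambda>j. (mode_impulse \<alpha> \<beta> \<eta> q j)\<^sup>2) sums noise_gain \<alpha> \<beta> \<eta> q"
proof -
  define b c where "b = mode_b \<alpha> \<beta> \<eta> q" and "c = mode_c \<alpha> \<beta> \<eta> q"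
  define D1 D2 where "D1 = 1 - \<beta> + \<alpha> * \<eta> * q" and "D2 = 2 + 2 * \<beta> - (1 + 2 * \<eta>) * \<alpha> * q"
  note st = stable_mode[OF assms]
  have "(\<lambda>j. \<alpha>\<^sup>2 * (impulse b c \<eta> j)\<^sup>2) sums
    (\<alpha>\<^sup>2 * ((((1 + \<eta>)\<^sup>2 + \<eta>\<^sup>2) * (1 + c) - 2 * b * \<eta> * (1 + \<eta>)) / ((1 - c) * ((1 + c)\<^sup>2 - b\<^sup>2))))"
    using assms(2) by (intro sums_mult impulse_energy) (simp add: b_def c_def mode_rho_def)
  \<comment> \<open>The difference of squares factors into \<open>1 + c - b\<close>, which is
    \<open>\<alpha> * q\<close>, and \<open>1 + c + b\<close>, which is \<open>D2\<close>. The
    \<open>\<alpha>\<close> split off here cancels one of the two in front.\<close>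
  moreover have "(1 - c) * ((1 + c)\<^sup>2 - b\<^sup>2) = \<alpha> * (q * D1 * D2)"
    unfolding b_def c_def mode_b_def mode_c_def D1_def D2_def by algebra
  moreover have "((1 + \<eta>)\<^sup>2 + \<eta>\<^sup>2) * (1 + c) - 2 * b * \<eta> * (1 + \<eta>) = 1 + \<beta> + (1 + 2 * \<eta>) * \<alpha> * \<eta> * q"
    unfolding b_def c_def mode_b_def mode_c_def by algebra
  moreover have "\<alpha>\<^sup>2 * (N / (\<alpha> * (q * D1 * D2))) = \<alpha> * N / (q * D1 * D2)" for N
    using st(1) by (simp add: power2_eq_square)
  ultimately show ?thesis
    by (simp add: noise_gain_def mode_impulse_def power_mult_distrib b_def c_def D1_def D2_def)
qed

text \<open>Jensen's inequality through a supporting plane: averaging the tangent inequality at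
  \<open>(U, V)\<close> over the two points with weights \<open>s\<close> and \<open>t\<close> turns
  its linear terms into \<open>U / U\<close> and \<open>V / V\<close>, leaving exactly
  \<open>1 / (U * V)\<close>.\<close>

lemma inverse_product_convex:
  fixes u0 u1 v0 v1 s t :: real
  assumes pos: "u0 > 0" "u1 > 0" "v0 > 0" "v1 > 0" and st: "s \<ge> 0" "t \<ge> 0" "s + t = 1"
  shows "1 / ((s * u0 + t * u1) * (s * v0 + t * v1)) \<le> s * (1 / (u0 * v0)) + t * (1 / (u1 * v1))"
proof -
  define U V where "U = s * u0 + t * u1" and "V = s * v0 + t * v1"
  have UV: "U > 0" "V > 0"
  proof -
    have "s > 0 \<or> t > 0" using st by linarith
    then show "U > 0" "V > 0" using pos st(1,2) unfolding U_def V_def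
      by (auto intro: add_pos_nonneg add_nonneg_pos)
  qed
  \<comment> \<open>the tangent plane of \<open>1 / (u v)\<close> at \<open>(U, V)\<close> lies below the graph\<close>
  have tangent: "(3 - u / U - v / V) / (U * V) \<le> 1 / (u * v)" if "u > 0" "v > 0" for u v
  proof -
    define x y where "x = u / U" and "y = v / V"
    have xy: "x > 0" "y > 0" using that UV by (simp_all add: x_def y_def)
    \<comment> \<open>In units of \<open>U\<close> and \<open>V\<close> the tangent inequality is a
      statement about \<open>x\<close> and \<open>y\<close> alone. Where
      \<open>x + y \<le> 3\<close>, bounding \<open>x * y\<close> by
      \<open>(x + y)\<^sup>2 / 4\<close> reduces it to one variable \<open>p = x + y\<close>, namely
      \<open>p\<^sup>2 * (3 - p) \<le> 4\<close>, with equality at \<open>p = 2\<close>.\<close>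
    have "x * y * (3 - x - y) \<le> 1"
    proof (cases "x + y \<le> 3")
      case True
      have "4 * (x * y) \<le> (x + y)\<^sup>2" using sum_squares_bound[of x y] by (simp add: power2_sum)
      then have "4 * (x * y) * (3 - x - y) \<le> (x + y)\<^sup>2 * (3 - x - y)"
        using True by (intro mult_right_mono) auto
      also have "\<dots> = 4 - (x + y - 2)\<^sup>2 * (x + y + 1)" by algebra
      also have "\<dots> \<le> 4" using xy by simp
      finally show ?thesis by simp
    next
      case False
      then have "x * y * (3 - x - y) \<le> 0" using xy by (intro mult_nonneg_nonpos) auto
      then show ?thesis by simp
    qed
    then have "3 - x - y \<le> 1 / (x * y)" using xy by (simp add: field_simps)
    then have "(3 - x - y) / (U * V) \<le> 1 / (x * y) / (U * V)" using UV by (intro divide_right_mono) auto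
    also have "\<dots> = 1 / (u * v)" using UV by (simp add: x_def y_def)
    finally show ?thesis by (simp add: x_def y_def)
  qed
  have "1 / (U * V) = (3 * (s + t) - U / U - V / V) / (U * V)" using UV st(3) by simp
  also have "\<dots> = s * ((3 - u0 / U - v0 / V) / (U * V)) + t * ((3 - u1 / U - v1 / V) / (U * V))"
  proof -
    have "U / U = s * (u0 / U) + t * (u1 / U)" "V / V = s * (v0 / V) + t * (v1 / V)"
      by (simp_all only: U_def V_def add_divide_distrib times_divide_eq_right)
    moreover have "(3 * (s + t) - (s * a + t * b) - (s * c + t * d)) / W = s * ((3 - a - c) / W) + t * ((3 - b - d) / W)"
      for a b c d W :: real by (simp add: algebra_simps diff_divide_distrib add_divide_distrib)
    ultimately show ?thesis by (simp only:)
  qed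
  also have "\<dots> \<le> s * (1 / (u0 * v0)) + t * (1 / (u1 * v1))"
    using pos st by (intro add_mono mult_left_mono tangent) auto
  finally show ?thesis by (simp add: U_def V_def)
qed

text \<open>The gain splits into two inverse products of positive affine functions of \<open>q\<close>, so it is convex.\<close>

lemma noise_gain_quasiconvex:
  assumes q: "0 < m" "m \<le> q" "q \<le> L" and stable: "mode_rho \<alpha> \<beta> \<eta> m < 1" "mode_rho \<alpha> \<beta> \<eta> L < 1"
  shows "noise_gain \<alpha> \<beta> \<eta> q \<le> max (noise_gain \<alpha> \<beta> \<eta> m) (noise_gain \<alpha> \<beta> \<eta> L)"
proof -
  define D1 D2 where "D1 q = 1 - \<beta> + \<alpha> * \<eta> * q" and "D2 q = 2 + 2 * \<beta> - (1 + 2 * \<eta>) * \<alpha> * q" for q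
  define h where "h q = \<alpha> / 2 * (1 / (q * D1 q)) + (1 + 2 * \<eta>)\<^sup>2 * \<alpha>\<^sup>2 / 2 * (1 / (D1 q * D2 q))" for q
  have "L > 0" using q by simp
  have "\<alpha> > 0" by (rule stable_mode(1)[OF q(1) stable(1)])
  have pos: "D1 m > 0" "D2 m > 0" "D1 L > 0" "D2 L > 0"
    unfolding D1_def D2_def using stable_mode[OF q(1) stable(1)] stable_mode[OF \<open>L > 0\<close> stable(2)] by blast+
  obtain s t where st: "s \<ge> 0" "t \<ge> 0" "s + t = 1" "q = s * m + t * L"
    using q(2,3) by (rule between_convex_combination)
  have D: "D1 q = s * D1 m + t * D1 L" "D2 q = s * D2 m + t * D2 L"
    unfolding D1_def D2_def using st(3,4) by algebra+
  have "s > 0 \<or> t > 0" using st by linarith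
  then have posq: "D1 q > 0" "D2 q > 0" "q > 0"
    using pos st(1,2) q unfolding D by (auto intro: add_pos_nonneg add_nonneg_pos)
  have gain: "noise_gain \<alpha> \<beta> \<eta> q = h q" if "q > 0" "D1 q > 0" "D2 q > 0" for q
  proof -
    \<comment> \<open>The numerator is split so that one part cancels the factor \<open>D2 q\<close>
      of the denominator and the other the factor \<open>q\<close>.\<close>
    have "1 + \<beta> + (1 + 2 * \<eta>) * \<alpha> * \<eta> * q = D2 q / 2 + (1 + 2 * \<eta>)\<^sup>2 * \<alpha> / 2 * q"
      unfolding D2_def by (simp add: power2_eq_square field_simps)
    then have "noise_gain \<alpha> \<beta> \<eta> q = \<alpha> * (D2 q / 2 + (1 + 2 * \<eta>)\<^sup>2 * \<alpha> / 2 * q) / (q * D1 q * D2 q)"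
      by (simp add: noise_gain_def D1_def D2_def)
    also have "\<dots> = h q" using that by (simp add: h_def field_simps power2_eq_square)
    finally show ?thesis .
  qed
  have "1 / (q * D1 q) \<le> s * (1 / (m * D1 m)) + t * (1 / (L * D1 L))"
    unfolding D by (subst st(4)) (intro inverse_product_convex pos st q(1) \<open>L > 0\<close>)
  moreover have "1 / (D1 q * D2 q) \<le> s * (1 / (D1 m * D2 m)) + t * (1 / (D1 L * D2 L))"
    unfolding D by (intro inverse_product_convex pos st)
  ultimately have "h q \<le> \<alpha> / 2 * (s * (1 / (m * D1 m)) + t * (1 / (L * D1 L)))
      + (1 + 2 * \<eta>)\<^sup>2 * \<alpha>\<^sup>2 / 2 * (s * (1 / (D1 m * D2 m)) + t * (1 / (D1 L * D2 L)))"
    unfolding h_def using \<open>\<alpha> > 0\<close> by (intro add_mono mult_left_mono) auto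
  also have "\<dots> = s * h m + t * h L" by (simp add: h_def algebra_simps)
  also have "\<dots> \<le> s * max (h m) (h L) + t * max (h m) (h L)"
    using st by (intro add_mono mult_left_mono) auto
  also have "\<dots> = max (h m) (h L)" using st(3) by (metis distrib_right mult_1)
  finally show ?thesis using gain posq pos q(1) \<open>L > 0\<close> by simp
qed


section \<open>Second moments of the output\<close>

text \<open>After expansion of the square the linear term vanishes by zero mean and the off-diagonal
  terms by uncorrelatedness.\<close>

lemma uncorrelated_second_moment:
  fixes X :: "nat \<Rightarrow> 'a \<Rightarrow> real"
  assumes "prob_space M"
    and X: "\<And>k. integrable M (X k)" "\<And>k. (\<integral>w. X k w \<partial>M) = 0"
    and XX: "\<And>j k. integrable M (\<lambda>w. X j w * X k w)" "\<And>j k. j \<noteq> k \<Longrightarrow> (\<integral>w. X j w * X k w \<partial>M) = 0"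
  shows "integrable M (\<lambda>w. (d - (\<Sum>k<t. a k * X k w))\<^sup>2)"
    and "(\<integral>w. (d - (\<Sum>k<t. a k * X k w))\<^sup>2 \<partial>M) = d\<^sup>2 + (\<Sum>k<t. (a k)\<^sup>2 * (\<integral>w. (X k w)\<^sup>2 \<partial>M))"
proof -
  interpret prob_space M by fact
  have expand: "(d - (\<Sum>k<t. a k * X k w))\<^sup>2 = d\<^sup>2 - 2 * d * (\<Sum>k<t. a k * X k w)
      + (\<Sum>j<t. \<Sum>k<t. a j * a k * (X j w * X k w))" for w
    by (simp add: power2_diff power2_eq_square[of "sum _ _"] sum_product ac_simps)
  show "integrable M (\<lambda>w. (d - (\<Sum>k<t. a k * X k w))\<^sup>2)"
    unfolding expand using X XX by (intro Bochner_Integration.integrable_add Bochner_Integration.integrable_diff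
      integrable_mult_right Bochner_Integration.integrable_sum integrable_const)
  have "(\<integral>w. (d - (\<Sum>k<t. a k * X k w))\<^sup>2 \<partial>M) = d\<^sup>2 - 2 * d * (\<Sum>k<t. a k * (\<integral>w. X k w \<partial>M))
      + (\<Sum>j<t. \<Sum>k<t. a j * a k * (\<integral>w. X j w * X k w \<partial>M))"
    unfolding expand using X(1) XX(1) by (simp add: prob_space)
  also have "(\<Sum>j<t. \<Sum>k<t. a j * a k * (\<integral>w. X j w * X k w \<partial>M)) = (\<Sum>j<t. \<Sum>k<t. if k = j then (a j)\<^sup>2 * (\<integral>w. (X j w)\<^sup>2 \<partial>M) else 0)"
    by (intro sum.cong refl) (auto simp: XX(2) power2_eq_square)
  finally show "(\<integral>w. (d - (\<Sum>k<t. a k * X k w))\<^sup>2 \<partial>M) = d\<^sup>2 + (\<Sum>k<t. (a k)\<^sup>2 * (\<integral>w. (X k w)\<^sup>2 \<partial>M))"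
    by (simp add: X(2))
qed

text \<open>Independence of the noise is exploited only here, for the vanishing cross moments at
  different times. The integrability of products includes \<open>j = k\<close>, where it says that
  each component is square integrable.\<close>

lemma noise_second_moments:
  fixes P :: "(nat \<Rightarrow> real^'d^1) measure" and e :: "real^'d"
  assumes P: "P \<in> noise \<sigma>"
  shows "integrable P (\<lambda>w. (norm (w k))\<^sup>2)" "(\<integral>w. (norm (w k))\<^sup>2 \<partial>P) \<le> \<sigma>\<^sup>2"
    and "integrable P (\<lambda>w. w k $ 1 \<bullet> e)" "(\<integral>w. w k $ 1 \<bullet> e \<partial>P) = 0"
    and "integrable P (\<lambda>w. (w j $ 1 \<bullet> e) * (w k $ 1 \<bullet> e))"
    and "j \<noteq> k \<Longrightarrow> (\<integral>w. (w j $ 1 \<bullet> e) * (w k $ 1 \<bullet> e) \<partial>P) = 0"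
proof -
  interpret prob_space P using P by (simp add: noise_def)
  have int: "integrable P (\<lambda>w. w k)" and mean: "(\<integral>w. w k \<partial>P) = 0"
    and sq: "(\<integral>\<^sup>+w. ennreal ((norm (w k))\<^sup>2) \<partial>P) \<le> ennreal (\<sigma>\<^sup>2)" for k
    using P by (simp_all add: noise_def)
  have [measurable]: "(\<lambda>w. w k) \<in> borel_measurable P" for k using int by (rule borel_measurable_integrable)
  have int2: "integrable P (\<lambda>w. (norm (w k))\<^sup>2)" for k
    using sq[of k] by (intro integrableI_bounded) (auto simp: less_top[symmetric] top_unique)
  then show "integrable P (\<lambda>w. (norm (w k))\<^sup>2)" .
  show "(\<integral>w. (norm (w k))\<^sup>2 \<partial>P) \<le> \<sigma>\<^sup>2"
    using sq[of k] nn_integral_eq_integral[OF int2] by simp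
  have lin: "bounded_linear (\<lambda>x :: real^'d^1. x $ 1 \<bullet> e)"
    by (intro bounded_linear_compose[OF bounded_linear_inner_left] bounded_linear_vec_nth)
  show i1: "integrable P (\<lambda>w. w k $ 1 \<bullet> e)" for k by (rule integrable_bounded_linear[OF lin int])
  show m1: "(\<integral>w. w k $ 1 \<bullet> e \<partial>P) = 0" for k
    using integral_bounded_linear[OF lin int[of k]] by (simp add: mean)
  have le: "\<bar>x $ 1 \<bullet> e\<bar> \<le> norm x * norm e" for x :: "real^'d^1"
    unfolding norm_vec_1[of x] by (rule Cauchy_Schwarz_ineq2)
  show "integrable P (\<lambda>w. (w j $ 1 \<bullet> e) * (w k $ 1 \<bullet> e))"
  proof (rule Bochner_Integration.integrable_bound)
    show "integrable P (\<lambda>w. ((norm (w j))\<^sup>2 + (norm (w k))\<^sup>2) * (norm e)\<^sup>2)"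
      by (intro integrable_mult_left Bochner_Integration.integrable_add int2)
    show "(\<lambda>w. (w j $ 1 \<bullet> e) * (w k $ 1 \<bullet> e)) \<in> borel_measurable P"
      using i1 by (intro borel_measurable_times borel_measurable_integrable)
    have "\<bar>(x $ 1 \<bullet> e) * (y $ 1 \<bullet> e)\<bar> \<le> ((norm x)\<^sup>2 + (norm y)\<^sup>2) * (norm e)\<^sup>2" for x y :: "real^'d^1"
    proof -
      have "\<bar>(x $ 1 \<bullet> e) * (y $ 1 \<bullet> e)\<bar> \<le> (norm x * norm e) * (norm y * norm e)"
        unfolding abs_mult by (intro mult_mono le) auto
      also have "\<dots> = (norm x * norm y) * (norm e)\<^sup>2" by (simp add: power2_eq_square)
      also have "norm x * norm y \<le> (norm x)\<^sup>2 + (norm y)\<^sup>2"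
      proof -
        have "0 \<le> norm x * norm y" by simp
        moreover have "2 * (norm x * norm y) \<le> (norm x)\<^sup>2 + (norm y)\<^sup>2"
          using sum_squares_bound[of "norm x" "norm y"] by (simp add: mult.assoc)
        ultimately show ?thesis by linarith
      qed
      finally show ?thesis by (simp add: mult_right_mono)
    qed
    then show "AE w in P. norm ((w j $ 1 \<bullet> e) * (w k $ 1 \<bullet> e)) \<le> norm (((norm (w j))\<^sup>2 + (norm (w k))\<^sup>2) * (norm e)\<^sup>2)"
      by (intro AE_I2) (simp add: abs_of_nonneg)
  qed
  assume "j \<noteq> k"
  have "indep_vars (\<lambda>_. borel) (\<lambda>t w. w t) UNIV" using P by (simp add: noise_def)
  then have "indep_vars (\<lambda>_. borel) (\<lambda>t w. w t $ 1 \<bullet> e) UNIV"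
    by (rule indep_vars_compose2) (use lin in \<open>auto intro: borel_measurable_continuous_onI linear_continuous_on\<close>)
  then have "indep_vars (\<lambda>_. borel) (\<lambda>t w. w t $ 1 \<bullet> e) {j, k}" by (rule indep_vars_subset) simp
  from indep_vars_lebesgue_integral[OF _ this i1] \<open>j \<noteq> k\<close>
  show "(\<integral>w. (w j $ 1 \<bullet> e) * (w k $ 1 \<bullet> e) \<partial>P) = 0" by (simp add: m1)
qed

lemma output_mode:
  fixes f :: "real^'d^1 \<Rightarrow> real"
  assumes "modal f B q" "e \<in> B"
  shows "(sys_output (three_param \<alpha> \<beta> \<eta>) f w \<xi>0 t - minimizer f) $ 1 \<bullet> e =
      (sys_output (three_param \<alpha> \<beta> \<eta>) f (\<lambda>_. 0) \<xi>0 t - minimizer f) $ 1 \<bullet> e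
      - (\<Sum>k<t. mode_impulse \<alpha> \<beta> \<eta> (q e) (t - Suc k) * (w k $ 1 \<bullet> e))"
proof -
  define Z where "Z w i t = (state (three_param \<alpha> \<beta> \<eta>) f w \<xi>0 t $ i - minimizer f $ 1) \<bullet> e" for w and i :: 2 and t
  note rec = mode_recursion[OF assms, of \<alpha> \<beta> \<eta> _ \<xi>0, folded Z_def]
  let ?b = "mode_b \<alpha> \<beta> \<eta> (q e)" and ?c = "mode_c \<alpha> \<beta> \<eta> (q e)"
  have "(1 + \<eta>) * Z w 1 t - \<eta> * Z w 2 t = (1 + \<eta>) * Z (\<lambda>_. 0) 1 t - \<eta> * Z (\<lambda>_. 0) 2 t
      - \<alpha> * (\<Sum>k<t. impulse ?b ?c \<eta> (t - Suc k) * (w k $ 1 \<bullet> e))"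
  proof (rule forced_solution)
    fix t
    show "Z w 1 (Suc t) = ?b * Z w 1 t - ?c * Z w 2 t - \<alpha> * (w t $ 1 \<bullet> e)" "Z w 2 (Suc t) = Z w 1 t"
      by (rule rec)+
    show "Z (\<lambda>_. 0) 1 (Suc t) = ?b * Z (\<lambda>_. 0) 1 t - ?c * Z (\<lambda>_. 0) 2 t" "Z (\<lambda>_. 0) 2 (Suc t) = Z (\<lambda>_. 0) 1 t"
      using rec(1,2)[of "\<lambda>_. 0" t] by simp_all
  qed (simp_all add: Z_def)
  then show ?thesis unfolding rec(3) by (simp add: mode_impulse_def sum_distrib_left mult.assoc)
qed

text \<open>Parseval is applied before taking expectations. Only the variance of each component
  \<open>w k $ 1 \<bullet> e\<close> then occurs, never the correlation between components at the
  same time, which the noise assumption leaves free.\<close>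

lemma output_second_moment:
  fixes f :: "real^'d^1 \<Rightarrow> real" and \<alpha> \<beta> \<eta> :: real and \<xi>0 :: "real^'d^2"
  assumes f: "modal f B q" and P: "P \<in> noise \<sigma>"
  defines "y \<equiv> \<lambda>w t. sys_output (three_param \<alpha> \<beta> \<eta>) f w \<xi>0 t - minimizer f"
  shows "integrable P (\<lambda>w. (norm (y w t))\<^sup>2)" (is ?int)
    and "(\<integral>w. (norm (y w t))\<^sup>2 \<partial>P) = (norm (y (\<lambda>_. 0) t))\<^sup>2
      + (\<Sum>e\<in>B. \<Sum>k<t. (mode_impulse \<alpha> \<beta> \<eta> (q e) (t - Suc k))\<^sup>2 * (\<integral>w. (w k $ 1 \<bullet> e)\<^sup>2 \<partial>P))" (is ?eq)
proof -
  have ps: "prob_space P" using P by (simp add: noise_def)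
  note moments = noise_second_moments(3-)[OF P]
  have y: "(norm (y w t))\<^sup>2 = (\<Sum>e\<in>B. (y w t $ 1 \<bullet> e)\<^sup>2)" for w
    using f unfolding norm_vec_1[of "y w t"] by (simp add: modal_def)
  have mode: "y w t $ 1 \<bullet> e = y (\<lambda>_. 0) t $ 1 \<bullet> e
      - (\<Sum>k<t. mode_impulse \<alpha> \<beta> \<eta> (q e) (t - Suc k) * (w k $ 1 \<bullet> e))" if "e \<in> B" for w e
    unfolding y_def by (rule output_mode[OF f that])
  have "integrable P (\<lambda>w. (y w t $ 1 \<bullet> e)\<^sup>2) \<and> (\<integral>w. (y w t $ 1 \<bullet> e)\<^sup>2 \<partial>P) = (y (\<lambda>_. 0) t $ 1 \<bullet> e)\<^sup>2
      + (\<Sum>k<t. (mode_impulse \<alpha> \<beta> \<eta> (q e) (t - Suc k))\<^sup>2 * (\<integral>w. (w k $ 1 \<bullet> e)\<^sup>2 \<partial>P))" if "e \<in> B" for e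
  proof -
    have eq: "(\<lambda>w. (y w t $ 1 \<bullet> e)\<^sup>2) = (\<lambda>w. (y (\<lambda>_. 0) t $ 1 \<bullet> e
      - (\<Sum>k<t. mode_impulse \<alpha> \<beta> \<eta> (q e) (t - Suc k) * (w k $ 1 \<bullet> e)))\<^sup>2)"
    proof
      fix w show "(y w t $ 1 \<bullet> e)\<^sup>2 = (y (\<lambda>_. 0) t $ 1 \<bullet> e
        - (\<Sum>k<t. mode_impulse \<alpha> \<beta> \<eta> (q e) (t - Suc k) * (w k $ 1 \<bullet> e)))\<^sup>2"
        by (simp only: mode[OF that, of w])
    qed
    show ?thesis unfolding eq
      by (intro conjI uncorrelated_second_moment[OF ps, where X = "\<lambda>k w. w k $ 1 \<bullet> e"] moments)
  qed
  then have int: "e \<in> B \<Longrightarrow> integrable P (\<lambda>w. (y w t $ 1 \<bullet> e)\<^sup>2)"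
    and mom: "e \<in> B \<Longrightarrow> (\<integral>w. (y w t $ 1 \<bullet> e)\<^sup>2 \<partial>P) = (y (\<lambda>_. 0) t $ 1 \<bullet> e)\<^sup>2
      + (\<Sum>k<t. (mode_impulse \<alpha> \<beta> \<eta> (q e) (t - Suc k))\<^sup>2 * (\<integral>w. (w k $ 1 \<bullet> e)\<^sup>2 \<partial>P))" for e by blast+
  show ?int unfolding y using int by (intro Bochner_Integration.integrable_sum)
  show ?eq unfolding y using int mom by (simp add: Bochner_Integration.integral_sum sum.distrib)
qed

text \<open>The trace of the covariance: however the noise distributes its power over the modes, the
  shares sum to the whole.\<close>

lemma noise_trace:
  fixes f :: "real^'d^1 \<Rightarrow> real"
  assumes f: "modal f B q" and P: "P \<in> noise \<sigma>"
  shows "(\<Sum>e\<in>B. \<integral>w. (w k $ 1 \<bullet> e)\<^sup>2 \<partial>P) = (\<integral>w. (norm (w k))\<^sup>2 \<partial>P)"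
proof -
  have "(norm (w k))\<^sup>2 = (\<Sum>e\<in>B. (w k $ 1 \<bullet> e)\<^sup>2)" for w :: "nat \<Rightarrow> real^'d^1"
    using f unfolding norm_vec_1[of "w k"] by (simp add: modal_def)
  moreover have "integrable P (\<lambda>w. (w k $ 1 \<bullet> e)\<^sup>2)" for e
    unfolding power2_eq_square by (rule noise_second_moments(5)[OF P])
  ultimately show ?thesis by (simp add: Bochner_Integration.integral_sum)
qed

text \<open>Finite second moments turn the extended integral in \<open>sens\<close> into real ones.
  At \<open>T = 0\<close> both sides are 0 because of the division by zero.\<close>

lemma mean_square_output:
  fixes f :: "real^'d^1 \<Rightarrow> real" and \<alpha> \<beta> \<eta> :: real and \<xi>0 :: "real^'d^2"
  assumes f: "modal f B q" and P: "P \<in> noise \<sigma>"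
  defines "y \<equiv> \<lambda>w t. sys_output (three_param \<alpha> \<beta> \<eta>) f w \<xi>0 t - minimizer f"
  shows "ereal_sqrt (enn2ereal (\<integral>\<^sup>+w. ennreal (1 / (\<sigma>\<^sup>2 * real T) * (\<Sum>t<T. (norm (y w t))\<^sup>2)) \<partial>P))
    = ereal (sqrt (1 / (\<sigma>\<^sup>2 * real T) * (\<Sum>t<T. \<integral>w. (norm (y w t))\<^sup>2 \<partial>P)))"
proof -
  have int: "integrable P (\<lambda>w. (norm (y w t))\<^sup>2)" for t
    unfolding y_def by (rule output_second_moment(1)[OF f P])
  have "(\<integral>\<^sup>+w. ennreal (1 / (\<sigma>\<^sup>2 * real T) * (\<Sum>t<T. (norm (y w t))\<^sup>2)) \<partial>P)
      = ennreal (\<integral>w. 1 / (\<sigma>\<^sup>2 * real T) * (\<Sum>t<T. (norm (y w t))\<^sup>2) \<partial>P)"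
    using int by (intro nn_integral_eq_integral integrable_mult_right Bochner_Integration.integrable_sum)
      (auto intro!: sum_nonneg divide_nonneg_nonneg)
  also have "(\<integral>w. 1 / (\<sigma>\<^sup>2 * real T) * (\<Sum>t<T. (norm (y w t))\<^sup>2) \<partial>P)
      = 1 / (\<sigma>\<^sup>2 * real T) * (\<Sum>t<T. \<integral>w. (norm (y w t))\<^sup>2 \<partial>P)"
    using int by (subst integral_mult_right_zero) (simp add: Bochner_Integration.integral_sum)
  finally show ?thesis
    by (simp add: ereal_sqrt_def enn2ereal_ennreal sum_nonneg divide_nonneg_nonneg)
qed


section \<open>The sensitivity\<close>

text \<open>Reordering by the time of the pulse: what enters at time \<open>k\<close> has
  contributed the first \<open>T - Suc k\<close> terms of its response before time
  \<open>T\<close>.\<close>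

lemma convolution_sum:
  fixes g m :: "nat \<Rightarrow> real"
  shows "(\<Sum>t<T. \<Sum>k<t. g (t - Suc k) * m k) = (\<Sum>k<T. (\<Sum>j<T - Suc k. g j) * m k)"
proof (induction T)
  case (Suc T)
  have "(\<Sum>k<T. (\<Sum>j<T - k. g j) * m k) = (\<Sum>k<T. (\<Sum>j<T - Suc k. g j) * m k + g (T - Suc k) * m k)"
  proof (intro sum.cong refl)
    fix k assume "k \<in> {..<T}"
    then have "T - k = Suc (T - Suc k)" by auto
    then show "(\<Sum>j<T - k. g j) * m k = (\<Sum>j<T - Suc k. g j) * m k + g (T - Suc k) * m k"
      by (simp only: sum.lessThan_Suc distrib_right)
  qed
  then show ?case using Suc by (simp add: sum.distrib)
qed simp

lemma cesaro_mean:
  fixes s :: "nat \<Rightarrow> real"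
  assumes "s \<longlonglongrightarrow> a"
  shows "(\<lambda>n. (\<Sum>k<n. s k) / real n) \<longlonglongrightarrow> a"
proof (rule LIMSEQ_I)
  fix \<epsilon> :: real assume \<epsilon>: "\<epsilon> > 0"
  obtain N where N: "\<And>n. n \<ge> N \<Longrightarrow> \<bar>s n - a\<bar> < \<epsilon> / 2"
    using LIMSEQ_D[OF assms, of "\<epsilon> / 2"] \<epsilon> by auto
  define C where "C = (\<Sum>k<N. \<bar>s k - a\<bar>)"
  obtain M :: nat where M: "2 * C / \<epsilon> < real M" using reals_Archimedean2 by blast
  have "norm ((\<Sum>k<n. s k) / real n - a) < \<epsilon>" if n: "n \<ge> max (Suc M) N" for n
  proof -
    have n0: "real n > 0" using n by simp
    have "\<bar>(\<Sum>k<n. s k) - real n * a\<bar> = \<bar>\<Sum>k<n. s k - a\<bar>" by (simp add: sum_subtractf)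
    also have "\<dots> \<le> (\<Sum>k<n. \<bar>s k - a\<bar>)" by (rule sum_abs)
    also have "\<dots> = C + (\<Sum>k=N..<n. \<bar>s k - a\<bar>)"
      using n sum.atLeastLessThan_concat[of 0 N n "\<lambda>k. \<bar>s k - a\<bar>"] by (simp add: C_def atLeast0LessThan)
    also have "(\<Sum>k=N..<n. \<bar>s k - a\<bar>) \<le> (\<Sum>k=N..<n. \<epsilon> / 2)" using N by (intro sum_mono) (simp add: less_imp_le)
    also have "\<dots> \<le> real n * (\<epsilon> / 2)" using \<epsilon> by (simp add: mult_right_mono)
    also have "C < real n * (\<epsilon> / 2)"
    proof -
      have "2 * C / \<epsilon> < real n" using M n by (auto intro: less_trans)
      then show ?thesis using \<epsilon> by (simp add: field_simps)
    qed
    finally have "\<bar>(\<Sum>k<n. s k) - real n * a\<bar> < \<epsilon> * real n" by (simp add: field_simps)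
    moreover have "(\<Sum>k<n. s k) / real n - a = ((\<Sum>k<n. s k) - real n * a) / real n" using n0 by (simp add: field_simps)
    ultimately show ?thesis using n0 by (simp add: abs_divide divide_less_eq)
  qed
  then show "\<exists>N. \<forall>n\<ge>N. norm ((\<Sum>k<n. s k) / real n - a) < \<epsilon>" by blast
qed

lemma exists_noise_full_power:
  assumes "0 < \<sigma>"
  obtains P :: "(nat \<Rightarrow> real^'d^1) measure" where "P \<in> noise \<sigma>" "\<And>k. (\<integral>w. (norm (w k))\<^sup>2 \<partial>P) = \<sigma>\<^sup>2"
proof -
  \<comment> \<open>The noise is a fixed vector of length \<open>\<sigma>\<close> with independent
    fair signs. Its direction is arbitrary, since it is applied to an isotropic quadratic.\<close>
  obtain u :: "real^'d^1" where u: "norm u = \<sigma>" using vector_choose_size assms less_imp_le by blast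
  define h where "h b = (if b then u else - u)" for b
  define N where "N = distr (measure_pmf (pmf_of_set UNIV)) borel h"
  define P where "P = (\<Pi>\<^sub>M t\<in>(UNIV :: nat set). N)"
  have [measurable]: "h \<in> measurable (measure_pmf p) borel" for p by simp
  interpret N: prob_space N unfolding N_def by (rule measure_pmf.prob_space_distr) simp
  interpret product_prob_space "\<lambda>_ :: nat. N" UNIV ..
  have sN: "sets N = sets borel" by (simp add: N_def)
  have psP: "prob_space P" unfolding P_def by (rule prob_space_axioms)
  have sP: "sets P = sets (\<Pi>\<^sub>M t\<in>UNIV. borel)" unfolding P_def by (intro sets_PiM_cong refl sN)
  have coord: "(\<lambda>w. w k) \<in> measurable P N" for k unfolding P_def by (rule measurable_component_singleton) simp
  then have coordb: "(\<lambda>w. w k) \<in> borel_measurable P" for k by (simp add: measurable_cong_sets[OF refl sN])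
  have marg: "distr P N (\<lambda>w. w k) = N" for k unfolding P_def by (rule PiM_component) simp
  have margb: "distr P borel (\<lambda>w. w k) = N" for k
    using marg[of k] distr_cong[of P P borel N "\<lambda>w. w k" "\<lambda>w. w k"] sN by simp
  have intN: "integrable N g" if "g \<in> borel_measurable borel" for g :: "real^'d^1 \<Rightarrow> 'b::{banach, second_countable_topology}"
    unfolding N_def using that by (subst integrable_distr_eq) (auto intro!: integrable_measure_pmf_finite)
  have lintN: "(\<integral>x. g x \<partial>N) = (1/2) *\<^sub>R (g u + g (- u))" if "g \<in> borel_measurable borel" for g :: "real^'d^1 \<Rightarrow> 'b::{banach, second_countable_topology}"
    unfolding N_def using that
    by (subst integral_distr) (auto simp: integral_measure_pmf[of UNIV] UNIV_bool h_def scaleR_add_right)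
  have intP: "integrable P (\<lambda>w. g (w k))" if "g \<in> borel_measurable borel" for g :: "real^'d^1 \<Rightarrow> 'b::{banach, second_countable_topology}" and k
    using intN[OF that] integrable_distr_eq[OF coordb that, of k] unfolding margb by simp
  have lintP: "(\<integral>w. g (w k) \<partial>P) = (1/2) *\<^sub>R (g u + g (- u))" if "g \<in> borel_measurable borel" for g :: "real^'d^1 \<Rightarrow> 'b::{banach, second_countable_topology}" and k
    using lintN[OF that] integral_distr[OF coordb that, of k] unfolding margb by simp
  have "(\<integral>w. (norm (w k))\<^sup>2 \<partial>P) = \<sigma>\<^sup>2" for k
    using lintP[of "\<lambda>x. (norm x)\<^sup>2" k] u by simp
  moreover have "P \<in> noise \<sigma>" unfolding noise_def
  proof (intro CollectI conjI allI psP sP)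
    show "prob_space.indep_vars P (\<lambda>_. borel) (\<lambda>t w. w t) UNIV"
    \<comment> \<open>Independence amounts to the joint law being the product of the marginals. The
      joint law of the coordinates is \<open>P\<close>, and all marginals are
      \<open>N\<close>.\<close>
    proof (subst prob_space.indep_vars_iff_distr_eq_PiM'[OF psP])
      have "distr P (\<Pi>\<^sub>M t\<in>UNIV. borel) (\<lambda>w. restrict w UNIV) = distr P P (\<lambda>w. w)"
        by (intro distr_cong) (simp_all add: sP restrict_def)
      then show "distr P (\<Pi>\<^sub>M t\<in>UNIV. borel) (\<lambda>w. \<lambda>t\<in>UNIV. w t) = (\<Pi>\<^sub>M t\<in>UNIV. distr P borel (\<lambda>w. w t))"
        unfolding margb P_def[symmetric] by (simp add: distr_id)
    qed (simp_all add: coordb)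
    fix k
    show "integrable P (\<lambda>w. w k)" using intP[of "\<lambda>x. x" k] by simp
    show "(\<integral>w. w k \<partial>P) = 0" using lintP[of "\<lambda>x. x" k] by simp
    have "(\<integral>\<^sup>+w. ennreal ((norm (w k))\<^sup>2) \<partial>P) = ennreal (\<integral>w. (norm (w k))\<^sup>2 \<partial>P)"
      by (intro nn_integral_eq_integral intP) auto
    then show "(\<integral>\<^sup>+w. ennreal ((norm (w k))\<^sup>2) \<partial>P) \<le> ennreal (\<sigma>\<^sup>2)"
      using lintP[of "\<lambda>x. (norm x)\<^sup>2" k] u by simp
  qed
  ultimately show thesis using that by blast
qed


text \<open>The bound does not depend on \<open>T\<close>, so the share of the initial state
  disappears when the energy is divided by \<open>T\<close>.\<close>

lemma output_energy_bound:
  fixes \<alpha> \<beta> \<eta> :: real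
  assumes "0 \<le> R" "R < 1"
  obtains M where "\<And>(f :: real^'d^1 \<Rightarrow> real) B q \<xi>0 T.
    modal f B q \<Longrightarrow> \<forall>e\<in>B. mode_rho \<alpha> \<beta> \<eta> (q e) \<le> R \<Longrightarrow>
    (\<Sum>t<T. (norm (sys_output (three_param \<alpha> \<beta> \<eta>) f (\<lambda>_. 0) \<xi>0 t - minimizer f))\<^sup>2)
      \<le> M * (norm (\<xi>0 - vector [minimizer f $ 1, minimizer f $ 1]))\<^sup>2"
proof -
  obtain r where r: "R < r" "r < 1" using dense[OF assms(2)] by blast
  have r0: "0 < r" using assms r by simp
  then have r2: "0 \<le> r\<^sup>2" "r\<^sup>2 < 1" using r by (simp_all add: power_less_one_iff)
  obtain M where M: "\<And>(f :: real^'d^1 \<Rightarrow> real) B q \<xi>0 t.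
    modal f B q \<Longrightarrow> \<forall>e\<in>B. mode_rho \<alpha> \<beta> \<eta> (q e) \<le> R \<Longrightarrow>
    (norm (state (three_param \<alpha> \<beta> \<eta>) f (\<lambda>_. 0) \<xi>0 t - vector [minimizer f $ 1, minimizer f $ 1]))\<^sup>2
      \<le> M * (r ^ t)\<^sup>2 * (norm (\<xi>0 - vector [minimizer f $ 1, minimizer f $ 1]))\<^sup>2"
    using state_geometric_bound[OF assms(1) r(1)] by metis
  \<comment> \<open>The factor \<open>\<bar>1 + \<eta>\<bar> + \<bar>\<eta>\<bar>\<close> bounds the
    output in terms of the state.\<close>
  define C where "C = (\<bar>1 + \<eta>\<bar> + \<bar>\<eta>\<bar>)\<^sup>2 * \<bar>M\<bar>"
  show thesis
  proof (rule that)
    fix f :: "real^'d^1 \<Rightarrow> real" and B q \<xi>0 T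
    assume f: "modal f B q" and q: "\<forall>e\<in>B. mode_rho \<alpha> \<beta> \<eta> (q e) \<le> R"
    let ?S = "state (three_param \<alpha> \<beta> \<eta>) f (\<lambda>_. 0) \<xi>0"
    let ?y = "sys_output (three_param \<alpha> \<beta> \<eta>) f (\<lambda>_. 0) \<xi>0"
    define s where "s = (vector [minimizer f $ 1, minimizer f $ 1] :: real^'d^2)"
    define N where "N = (norm (\<xi>0 - s))\<^sup>2"
    have "(norm (?y t - minimizer f))\<^sup>2 \<le> C * N * (r\<^sup>2) ^ t" for t
    proof -
      have "(?y t - minimizer f) $ 1 = (1 + \<eta>) *\<^sub>R (?S t - s) $ 1 - \<eta> *\<^sub>R (?S t - s) $ 2"
        by (simp add: state_three_param(3) s_def algebra_simps)
      then have "norm (?y t - minimizer f) \<le> norm ((1 + \<eta>) *\<^sub>R (?S t - s) $ 1) + norm (\<eta> *\<^sub>R (?S t - s) $ 2)"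
        unfolding norm_vec_1[of "?y t - minimizer f"] by (metis norm_triangle_ineq4)
      also have "\<dots> \<le> \<bar>1 + \<eta>\<bar> * norm (?S t - s) + \<bar>\<eta>\<bar> * norm (?S t - s)"
        unfolding norm_scaleR by (intro add_mono mult_left_mono Finite_Cartesian_Product.norm_nth_le) auto
      also have "\<dots> = (\<bar>1 + \<eta>\<bar> + \<bar>\<eta>\<bar>) * norm (?S t - s)" by (simp add: distrib_right)
      finally have "(norm (?y t - minimizer f))\<^sup>2 \<le> ((\<bar>1 + \<eta>\<bar> + \<bar>\<eta>\<bar>) * norm (?S t - s))\<^sup>2"
        by (intro power_mono) auto
      also have "\<dots> = (\<bar>1 + \<eta>\<bar> + \<bar>\<eta>\<bar>)\<^sup>2 * (norm (?S t - s))\<^sup>2" by (rule power_mult_distrib)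
      also have "\<dots> \<le> (\<bar>1 + \<eta>\<bar> + \<bar>\<eta>\<bar>)\<^sup>2 * (\<bar>M\<bar> * (r ^ t)\<^sup>2 * N)"
      proof (rule mult_left_mono)
        have "(norm (?S t - s))\<^sup>2 \<le> M * (r ^ t)\<^sup>2 * N" unfolding s_def N_def by (rule M[OF f q])
        also have "\<dots> \<le> \<bar>M\<bar> * (r ^ t)\<^sup>2 * N" unfolding N_def by (intro mult_right_mono) auto
        finally show "(norm (?S t - s))\<^sup>2 \<le> \<bar>M\<bar> * (r ^ t)\<^sup>2 * N" .
      qed simp
      also have "\<dots> = C * N * (r\<^sup>2) ^ t" by (simp add: C_def power_mult[symmetric] mult.commute)
      finally show ?thesis .
    qed
    then have "(\<Sum>t<T. (norm (?y t - minimizer f))\<^sup>2) \<le> (\<Sum>t<T. C * N * (r\<^sup>2) ^ t)" by (rule sum_mono)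
    also have "\<dots> = C * N * (\<Sum>t<T. (r\<^sup>2) ^ t)" by (simp add: sum_distrib_left)
    also have "\<dots> \<le> C * N * (1 / (1 - r\<^sup>2))"
    proof (rule mult_left_mono)
      have "(\<Sum>t<T. (r\<^sup>2) ^ t) \<le> (\<Sum>t. (r\<^sup>2) ^ t)"
        using r2 by (intro sum_le_suminf summable_geometric) auto
      also have "\<dots> = 1 / (1 - r\<^sup>2)" using r2 by (intro suminf_geometric) auto
      finally show "(\<Sum>t<T. (r\<^sup>2) ^ t) \<le> 1 / (1 - r\<^sup>2)" .
    qed (simp add: C_def N_def)
    also have "\<dots> = (C * (1 / (1 - r\<^sup>2))) * N" by simp
    finally show "(\<Sum>t<T. (norm (?y t - minimizer f))\<^sup>2)
        \<le> (C * (1 / (1 - r\<^sup>2))) * (norm (\<xi>0 - vector [minimizer f $ 1, minimizer f $ 1]))\<^sup>2"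
      unfolding N_def s_def .
  qed
qed

text \<open>Each pulse contributes at most the complete energy of its response, which is the mode
  gain and thus at most \<open>G\<close>. With a common factor the variances can be summed over the
  modes to the total power.\<close>

lemma noise_energy_bound:
  fixes f :: "real^'d^1 \<Rightarrow> real"
  assumes f: "modal f B q" and P: "P \<in> noise \<sigma>"
    and q: "\<And>e. e \<in> B \<Longrightarrow> 0 < q e \<and> mode_rho \<alpha> \<beta> \<eta> (q e) < 1 \<and> noise_gain \<alpha> \<beta> \<eta> (q e) \<le> G"
    and G: "0 \<le> G"
  shows "(\<Sum>t<T. \<Sum>e\<in>B. \<Sum>k<t. (mode_impulse \<alpha> \<beta> \<eta> (q e) (t - Suc k))\<^sup>2 * (\<integral>w. (w k $ 1 \<bullet> e)\<^sup>2 \<partial>P))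
    \<le> G * (\<sigma>\<^sup>2 * real T)"
proof -
  have conv: "(\<Sum>t<T. \<Sum>k<t. (mode_impulse \<alpha> \<beta> \<eta> (q e) (t - Suc k))\<^sup>2 * (\<integral>w. (w k $ 1 \<bullet> e)\<^sup>2 \<partial>P))
      = (\<Sum>k<T. (\<Sum>j<T - Suc k. (mode_impulse \<alpha> \<beta> \<eta> (q e) j)\<^sup>2) * (\<integral>w. (w k $ 1 \<bullet> e)\<^sup>2 \<partial>P))" for e
    by (rule convolution_sum[where g = "\<lambda>j. (mode_impulse \<alpha> \<beta> \<eta> (q e) j)\<^sup>2"])
  have "(\<Sum>t<T. \<Sum>e\<in>B. \<Sum>k<t. (mode_impulse \<alpha> \<beta> \<eta> (q e) (t - Suc k))\<^sup>2 * (\<integral>w. (w k $ 1 \<bullet> e)\<^sup>2 \<partial>P))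
      = (\<Sum>e\<in>B. \<Sum>k<T. (\<Sum>j<T - Suc k. (mode_impulse \<alpha> \<beta> \<eta> (q e) j)\<^sup>2) * (\<integral>w. (w k $ 1 \<bullet> e)\<^sup>2 \<partial>P))"
    by (subst sum.swap[where A = "{..<T}" and B = B]) (simp only: conv)
  also have "\<dots> \<le> (\<Sum>e\<in>B. \<Sum>k<T. G * (\<integral>w. (w k $ 1 \<bullet> e)\<^sup>2 \<partial>P))"
  proof (intro sum_mono mult_right_mono)
    fix e k assume "e \<in> B"
    note e = q[OF this]
    have sums: "(\<lambda>j. (mode_impulse \<alpha> \<beta> \<eta> (q e) j)\<^sup>2) sums noise_gain \<alpha> \<beta> \<eta> (q e)"
      using e by (intro mode_impulse_energy) auto
    have "(\<Sum>j<T - Suc k. (mode_impulse \<alpha> \<beta> \<eta> (q e) j)\<^sup>2) \<le> (\<Sum>j. (mode_impulse \<alpha> \<beta> \<eta> (q e) j)\<^sup>2)"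
      using sums_summable[OF sums] by (intro sum_le_suminf) auto
    also have "\<dots> = noise_gain \<alpha> \<beta> \<eta> (q e)" using sums by (rule sums_unique[symmetric])
    finally show "(\<Sum>j<T - Suc k. (mode_impulse \<alpha> \<beta> \<eta> (q e) j)\<^sup>2) \<le> G" using e by linarith
  qed simp
  also have "\<dots> = G * (\<Sum>k<T. \<integral>w. (norm (w k))\<^sup>2 \<partial>P)"
    unfolding noise_trace[OF f P, symmetric] by (subst sum.swap) (simp add: sum_distrib_left)
  also have "\<dots> \<le> G * (\<Sum>k<T. \<sigma>\<^sup>2)"
    using G by (intro mult_left_mono sum_mono noise_second_moments(2)[OF P]) auto
  finally show ?thesis by (simp add: mult.commute)
qed

lemma noise_gain_nonneg:
  assumes "0 < q" "mode_rho \<alpha> \<beta> \<eta> q < 1"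
  shows "0 \<le> noise_gain \<alpha> \<beta> \<eta> q"
  by (rule sums_le[OF _ sums_zero mode_impulse_energy[OF assms]]) simp

text \<open>From above, the mean energy is at most the largest endpoint gain plus a term of order
  \<open>1 / T\<close> from the initial state. From below, starting at the fixed point makes the
  mean energy a Cesaro mean of partial sums that converge to the gain.\<close>

lemma sens_three_param:
  assumes m: "0 < m" "m \<le> L" and \<sigma>: "0 < \<sigma>"
    and stable: "mode_rho \<alpha> \<beta> \<eta> m < 1" "mode_rho \<alpha> \<beta> \<eta> L < 1"
  shows "sens \<sigma> (three_param \<alpha> \<beta> \<eta>) (quad_class m L :: (real^'d^1 \<Rightarrow> real) set)
    = ereal (sqrt (max (noise_gain \<alpha> \<beta> \<eta> m) (noise_gain \<alpha> \<beta> \<eta> L)))" (is "?sens = ereal (sqrt ?G)")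
proof (rule antisym)
  let ?A = "three_param \<alpha> \<beta> \<eta>"
  let ?R = "max (mode_rho \<alpha> \<beta> \<eta> m) (mode_rho \<alpha> \<beta> \<eta> L)"
  have L: "0 < L" using m by simp
  have R: "0 \<le> ?R" "?R < 1" using stable by (auto simp: mode_rho_def le_max_iff_disj char_radius_nonneg)
  have G: "0 \<le> ?G" using noise_gain_nonneg[OF m(1) stable(1)] by (simp add: le_max_iff_disj)
  obtain M where M: "\<And>(f :: real^'d^1 \<Rightarrow> real) B q \<xi>0 T.
    modal f B q \<Longrightarrow> \<forall>e\<in>B. mode_rho \<alpha> \<beta> \<eta> (q e) \<le> ?R \<Longrightarrow>
    (\<Sum>t<T. (norm (sys_output ?A f (\<lambda>_. 0) \<xi>0 t - minimizer f))\<^sup>2)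
      \<le> M * (norm (\<xi>0 - vector [minimizer f $ 1, minimizer f $ 1]))\<^sup>2"
    using output_energy_bound[OF R] by metis
  show "?sens \<le> ereal (sqrt ?G)" unfolding sens_def
  proof (intro SUP_least)
    fix f :: "real^'d^1 \<Rightarrow> real" and \<xi>0 :: "real^'d^2" and P :: "(nat \<Rightarrow> real^'d^1) measure"
    assume fQ: "f \<in> quad_class m L" and P: "P \<in> noise \<sigma>"
    obtain B q where f: "modal f B q" and q: "\<And>e. e \<in> B \<Longrightarrow> m \<le> q e \<and> q e \<le> L"
      using quad_class_modal[OF fQ m(1)] by metis
    have rho: "\<forall>e\<in>B. mode_rho \<alpha> \<beta> \<eta> (q e) \<le> ?R" using q mode_rho_quasiconvex by metis
    have modes: "0 < q e \<and> mode_rho \<alpha> \<beta> \<eta> (q e) < 1 \<and> noise_gain \<alpha> \<beta> \<eta> (q e) \<le> ?G" if "e \<in> B" for e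
      using q[OF that] rho that R(2) m(1) noise_gain_quasiconvex[OF m(1) _ _ stable, of "q e"] by fastforce
    define D where "D = M * (norm (\<xi>0 - vector [minimizer f $ 1, minimizer f $ 1]))\<^sup>2"
    have bound: "1 / (\<sigma>\<^sup>2 * real T) * (\<Sum>t<T. \<integral>w. (norm (sys_output ?A f w \<xi>0 t - minimizer f))\<^sup>2 \<partial>P)
        \<le> D / \<sigma>\<^sup>2 / real T + ?G" for T
    \<comment> \<open>At \<open>T = 0\<close> the divisions by zero reduce the claim to
      \<open>0 \<le> ?G\<close>.\<close>
    proof (cases "T = 0")
      case False
      have "(\<Sum>t<T. \<integral>w. (norm (sys_output ?A f w \<xi>0 t - minimizer f))\<^sup>2 \<partial>P) \<le> D + ?G * (\<sigma>\<^sup>2 * real T)"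
        unfolding output_second_moment(2)[OF f P] sum.distrib D_def
        by (intro add_mono M[OF f rho] noise_energy_bound[OF f P modes G])
      then have "1 / (\<sigma>\<^sup>2 * real T) * (\<Sum>t<T. \<integral>w. (norm (sys_output ?A f w \<xi>0 t - minimizer f))\<^sup>2 \<partial>P)
          \<le> 1 / (\<sigma>\<^sup>2 * real T) * (D + ?G * (\<sigma>\<^sup>2 * real T))" by (intro mult_left_mono) auto
      also have "\<dots> = D / \<sigma>\<^sup>2 / real T + ?G" using False \<sigma> by (simp add: add_divide_distrib)
      finally show ?thesis .
    qed (use G in simp)
    have "limsup (\<lambda>T. ereal_sqrt (enn2ereal (\<integral>\<^sup>+w. ennreal (1 / (\<sigma>\<^sup>2 * real T) *
         (\<Sum>t<T. (norm (sys_output ?A f w \<xi>0 t - minimizer f))\<^sup>2)) \<partial>P)))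
       \<le> limsup (\<lambda>T. ereal (sqrt (D / \<sigma>\<^sup>2 / real T + ?G)))"
      unfolding mean_square_output[OF f P] using bound
      by (intro Limsup_mono always_eventually allI) (simp only: ereal_less_eq real_sqrt_le_iff)
    also have "\<dots> = ereal (sqrt (0 + ?G))"
      by (intro lim_imp_Limsup tendsto_intros sequentially_bot lim_const_over_n)
    finally show "limsup (\<lambda>T. ereal_sqrt (enn2ereal (\<integral>\<^sup>+w. ennreal (1 / (\<sigma>\<^sup>2 * real T) *
         (\<Sum>t<T. (norm (sys_output ?A f w \<xi>0 t - minimizer f))\<^sup>2)) \<partial>P))) \<le> ereal (sqrt ?G)" by simp
  qed
  obtain P :: "(nat \<Rightarrow> real^'d^1) measure" where P: "P \<in> noise \<sigma>" and power: "\<And>k. (\<integral>w. (norm (w k))\<^sup>2 \<partial>P) = \<sigma>\<^sup>2"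
    using exists_noise_full_power[OF \<sigma>] by metis
  have lower: "ereal (sqrt (noise_gain \<alpha> \<beta> \<eta> q)) \<le> ?sens" if q: "m \<le> q" "q \<le> L" "mode_rho \<alpha> \<beta> \<eta> q < 1" for q
  proof -
    have q0: "0 < q" using q m by simp
    obtain f :: "real^'d^1 \<Rightarrow> real" where fQ: "f \<in> quad_class m L" and f0: "minimizer f = 0"
      and f: "modal f Basis (\<lambda>_. q)"
      using isotropic_quadratic[OF m(1) q(1,2)] by blast
    let ?g = "\<lambda>j. (mode_impulse \<alpha> \<beta> \<eta> q j)\<^sup>2"
    have E: "(\<integral>w. (norm (sys_output ?A f w 0 t - minimizer f))\<^sup>2 \<partial>P) = \<sigma>\<^sup>2 * (\<Sum>j<t. ?g j)" for t
    proof -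
      have "(\<integral>w. (norm (sys_output ?A f w 0 t - minimizer f))\<^sup>2 \<partial>P)
          = (\<Sum>e\<in>Basis. \<Sum>k<t. ?g (t - Suc k) * (\<integral>w. (w k $ 1 \<bullet> e)\<^sup>2 \<partial>P))"
        unfolding output_second_moment(2)[OF f P] by (simp add: sys_output_def state_zero_fixed[OF f f0] f0)
      also have "\<dots> = (\<Sum>k<t. ?g (t - Suc k) * (\<Sum>e\<in>Basis. \<integral>w. (w k $ 1 \<bullet> e)\<^sup>2 \<partial>P))"
        by (subst sum.swap) (simp add: sum_distrib_left)
      also have "\<dots> = \<sigma>\<^sup>2 * (\<Sum>k<t. ?g (t - Suc k))"
        unfolding noise_trace[OF f P] power by (simp add: sum_distrib_left mult.commute)
      finally show ?thesis using sum.nat_diff_reindex[of ?g t] by simp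
    qed
    \<comment> \<open>Full power at every time makes \<open>\<sigma>\<^sup>2\<close> cancel, so the
      limit does not depend on the noise level.\<close>
    have avg: "1 / (\<sigma>\<^sup>2 * real T) * (\<Sum>t<T. \<integral>w. (norm (sys_output ?A f w 0 t - minimizer f))\<^sup>2 \<partial>P)
        = (\<Sum>t<T. \<Sum>j<t. ?g j) / real T" for T
      unfolding E sum_distrib_left[symmetric] using \<sigma> by simp
    have "(\<lambda>T. \<Sum>j<T. ?g j) \<longlonglongrightarrow> noise_gain \<alpha> \<beta> \<eta> q"
      using mode_impulse_energy[OF q0 q(3)] by (simp only: sums_def)
    then have "(\<lambda>T. (\<Sum>t<T. \<Sum>j<t. ?g j) / real T) \<longlonglongrightarrow> noise_gain \<alpha> \<beta> \<eta> q" by (rule cesaro_mean)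
    then have "(\<lambda>T. ereal (sqrt ((\<Sum>t<T. \<Sum>j<t. ?g j) / real T))) \<longlonglongrightarrow> ereal (sqrt (noise_gain \<alpha> \<beta> \<eta> q))"
      by (intro tendsto_ereal tendsto_real_sqrt)
    then have "limsup (\<lambda>T. ereal (sqrt ((\<Sum>t<T. \<Sum>j<t. ?g j) / real T))) = ereal (sqrt (noise_gain \<alpha> \<beta> \<eta> q))"
      by (rule lim_imp_Limsup[OF sequentially_bot])
    then have "ereal (sqrt (noise_gain \<alpha> \<beta> \<eta> q)) = limsup (\<lambda>T. ereal_sqrt (enn2ereal (\<integral>\<^sup>+w. ennreal (1 / (\<sigma>\<^sup>2 * real T) *
         (\<Sum>t<T. (norm (sys_output ?A f w 0 t - minimizer f))\<^sup>2)) \<partial>P)))"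
      unfolding mean_square_output[OF f P] avg by (rule sym)
    also have "\<dots> \<le> ?sens" unfolding sens_def
      by (rule SUP_upper2[where i = f], rule fQ, rule SUP_upper2[where i = 0], rule UNIV_I,
          rule SUP_upper2[where i = P], rule P, rule order_refl)
    finally show ?thesis .
  qed
  show "ereal (sqrt ?G) \<le> ?sens"
    using lower[of m] lower[of L] m(2) stable by (cases "noise_gain \<alpha> \<beta> \<eta> m \<le> noise_gain \<alpha> \<beta> \<eta> L") (simp_all add: max_def)
qed

theorem corollary3p2:
  fixes m L \<alpha> \<beta> \<eta> \<sigma> :: real
  assumes "0 < m" and "m \<le> L" and "0 < \<sigma>"
  shows "rate (three_param \<alpha> \<beta> \<eta>) (quad_class m L :: (real^'d^1 \<Rightarrow> real) set) =
      ereal (MAX q\<in>{m, L}.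
        let \<Delta> = (\<beta> + 1 - \<alpha> * q - \<alpha> * \<eta> * q)\<^sup>2 - 4 * (\<beta> - \<alpha> * \<eta> * q)
        in if \<Delta> < 0 then sqrt (\<beta> - \<alpha> * \<eta> * q)
           else 1/2 * (\<bar>\<beta> + 1 - \<alpha> * q - \<alpha> * \<eta> * q\<bar> + sqrt \<Delta>))
    \<and> (rate (three_param \<alpha> \<beta> \<eta>) (quad_class m L :: (real^'d^1 \<Rightarrow> real) set) < 1 \<longrightarrow>
       sens \<sigma> (three_param \<alpha> \<beta> \<eta>) (quad_class m L :: (real^'d^1 \<Rightarrow> real) set) =
      ereal (MAX q\<in>{m, L}.
        sqrt (\<alpha> * (1 + \<beta> + (1 + 2 * \<eta>) * \<alpha> * \<eta> * q) /
              (q * (1 - \<beta> + \<alpha> * \<eta> * q) * (2 + 2 * \<beta> - (1 + 2 * \<eta>) * \<alpha> * q)))))"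
proof -
  have Max2: "(MAX q\<in>{m, L}. h q) = max (h m) (h L)" for h :: "real \<Rightarrow> real" by simp
  \<comment> \<open>Read from right to left, the definition folds the case distinction of the
    statement back into \<open>mode_rho\<close>.\<close>
  note rho = mode_rho_def[of \<alpha> \<beta> \<eta>, unfolded char_radius_def mode_b_def mode_c_def, symmetric]
  note rate = rate_three_param[OF assms(1,2), where 'd = 'd, of \<alpha> \<beta> \<eta>]
  have sqrt_max: "max (sqrt x) (sqrt y) = sqrt (max x y)" for x y by (simp add: max_def)
  show ?thesis
    unfolding Max2 rho noise_gain_def[symmetric] sqrt_max rate
    using sens_three_param[OF assms, where 'd = 'd, of \<alpha> \<beta> \<eta>] by simp
qed

end
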